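(* Let $k\ge 1$ and $n\ge 1$ be integers, let $\mathcal{C}$ be the configuration space of the articulated arm $(M_0,\dots,M_{n+1})$ of length $n+1$ in $\mathbb{R}^{k+1}$, $\Delta$ the distribution $\Delta(q)=T_q\mathcal{C}\cap\mathcal{E}(q)$ on $\mathcal{C}$, $\mathcal{S}=\mathbb{R}^{k+1}\times(\mathbb{S}^k)^{n+1}$, $\Gamma:\mathcal{C}\to\mathcal{S}$ the diffeomorphism $\Gamma(x_0,\dots,x_{n+1})=(x_0,x_1-x_0,\dots,x_{n+1}-x_n)$, and $\Delta_n$ the distribution on $\mathcal{S}$ generated, in hyperspherical coordinates, by $X_n^0,X_n^1,\dots,X_n^k$ (all defined in the context). Then: (1) On $\mathcal{S}$, the distribution $\Delta_n$ is the image by $\Gamma$ of the distribution $\Delta$. (2) The evolution of the articulated arm of length $n+1$ is described, in a chart $(x,\theta_0,\dots,\theta_n)$ of $\mathcal{S}$ (where $x=x_0$), by the following controlled system with $k+1$ controls: $$\begin{cases}\dot x^r=v_0\,\phi_0^r, & r=1,\dots,k+1,\\ \dot\theta_i^j=v_{i+1}B_{i+1}^j, & i=0,\dots,n-1,\ j=1,\dots,k,\\ \dot\theta_n^j=v_{\theta_n^j}, & j=1,\dots,k,\end{cases}$$ where $v_i=v_n\prod_{r=i+1}^{n}A_r$ and $(v_{\theta_n^1},\dots,v_{\theta_n^k},v_n)$ are the $k+1$ controls of the system. Moreover: $\bullet$ $(v_{\theta_n^1},\dots,v_{\theta_n^k})$ are the "tangential components" of the velocity of $M_{n+1}$, namely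 the components, in the canonical basis $\{\Theta_n^1(x_{n+1}),\dots,\Theta_n^k(x_{n+1})\}$ of $T_{x_{n+1}}\tilde{\mathbb{S}}_n$, of the orthogonal projection of the velocity of $M_{n+1}$; $\bullet$ $v_{i-1}$ is the "normal velocity" of $M_i$ for all $i=1,\dots,n+1$, namely the component of the orthogonal projection of the velocity of $M_i$ on the direction generated by $\nu_{i-1}(x_i)$.
   Context: Articulated arm and its evolution. Write a point of $(\mathbb{R}^{k+1})^{n+2}$ as $q=(x_0,\dots,x_{n+1})$, with $x_i=(x_i^1,\dots,x_i^{k+1})\in\mathbb{R}^{k+1}$ the position of the point $M_i$, and use the canonical scalar product. All segments $[M_i,M_{i+1}]$ have length $1$; the configuration space is $$\mathcal{C}=\{(x_0,\dots,x_{n+1}) : \|x_i-x_{i+1}\|^2-1=0,\ i=0,\dots,n\}.$$ Put $\mathcal{Z}_i=\sum_{r=1}^{k+1}(x_{i+1}^r-x_i^r)\frac{\partial}{\partial x_i^r}$ for $i=0,\dots,n$, and let $\mathcal{E}$ be the distribution generated by $\mathcal{Z}_0,\dots,\mathcal{Z}_n,\frac{\partial}{\partial x_{n+1}^1},\dots,\frac{\partial}{\partial x_{n+1}^{k+1}}$. The kinematic evolution of the arm is the motion under the constraint that the velocity of each $M_i$ is collinear with the segment $[M_i,M_{i+1}]$ for $i=0,\dots,n$; it is described by the controlled system $\dot q=\sum_{i=0}^n u_i\mathcal{Z}_i+\sum_{r=1}^{k+1}u_{n+r}\frac{\partial}{\partial x_{n+1}^r}$ with the constraints $\|x_i-x_{i+1}\|=1$,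 $i=0,\dots,n$. Hyperspherical coordinates. On $\mathbb{R}^{k+1}$ they are given by $z=\hat\Phi(\rho,\theta)=\rho\,\Phi(\theta)$, $\theta=(\theta^1,\dots,\theta^k)$, $\Phi=(\phi^1,\dots,\phi^{k+1})$, with $\phi^1=\sin\theta^1\cdots\sin\theta^{k-1}\sin\theta^k$, $\phi^2=\sin\theta^1\cdots\sin\theta^{k-1}\cos\theta^k$, $\phi^3=\sin\theta^1\cdots\sin\theta^{k-2}\cos\theta^{k-1}$, ..., $\phi^k=\sin\theta^1\cos\theta^2$, $\phi^{k+1}=\cos\theta^1$. Charts of $\mathcal{S}$. Write points of $\mathcal{S}$, considered as a subset of $(\mathbb{R}^{k+1})^{n+2}$, as $(x_0,z_1,\dots,z_{n+1})$, so that $\Gamma$ is given by $x_0=x_0$ and $z_i=x_i-x_{i-1}$, $i=1,\dots,n+1$. For $i=0,\dots,n$, let $\mathbb{S}_i$ be the canonical unit sphere in the copy of $\mathbb{R}^{k+1}$ with coordinates $z_{i+1}$. Given a point $\alpha\in\mathbb{S}_i$, one takes a hyperspherical chart $z_{i+1}=\hat\Phi_i(\rho_i,\theta_i)=\rho_i\Phi_i(\theta_i^1,\dots,\theta_i^k)$, with $\Phi_i=(\phi_i^1,\dots,\phi_i^{k+1})$, defined for $0\le\theta_i^k\le 2\pi$ and $0<\theta_i^j<\pi$, $j=1,\dots,k-1$, where $\Phi_i(0,\dots,0)=\alpha$. Together with the coordinate $x=x_0$ and restricted to $\rho_i=1$, $i=0,\dots,n$, these induce a chart of $\mathcal{S}$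 with coordinates $(x,\theta_0,\dots,\theta_n)$. Moving frames. For $q=(x_0,\dots,x_{n+1})\in\mathcal{C}$ and $i=0,\dots,n$, $\tilde{\mathbb{S}}_i$ is the sphere in $\mathbb{R}^{k+1}$ of center $x_i$ and radius $1$; it contains $x_{i+1}$. Put on $\mathbb{R}^{k+1}$ the hyperspherical coordinates $y_i=\hat\Phi_i(\rho_i,\theta_i)+x_i$, and let $\{\nu_i,\Theta_i^1,\dots,\Theta_i^k\}$ be the image by the differential of this map of the canonical frame $\{\frac{\partial}{\partial\rho_i},\frac{\partial}{\partial\theta_i^1},\dots,\frac{\partial}{\partial\theta_i^k}\}$. Then $\nu_i(x_{i+1})$ is the outward unit normal of $\tilde{\mathbb{S}}_i$ at $x_{i+1}$ and $\{\Theta_i^1(x_{i+1}),\dots,\Theta_i^k(x_{i+1})\}$ is a basis of $T_{x_{i+1}}\tilde{\mathbb{S}}_i$. Functions and vector fields on $\mathcal{S}$ in hyperspherical coordinates: $A_i=\sum_{r=1}^{k+1}\phi_{i-1}^r\phi_i^r$ for $i=1,\dots,n$, and $A_{n+1}=1$; $B_i^1=\sum_{r=1}^{k+1}\frac{\partial\phi_{i-1}^r}{\partial\theta_{i-1}^1}\phi_i^r$ for $i=1,\dots,n$; $B_i^j=\frac{1}{\left\|\frac{\partial\phi_{i-1}}{\partial\theta_{i-1}^j}\right\|}\sum_{r=1}^{k+1}\frac{\partial\phi_{i-1}^r}{\partial\theta_{i-1}^j}\phi_i^r$ for $i=1,\dots,n$ and $j=2,\dots,k$, where $\frac{\partial\phi_{i-1}}{\partial\theta_{i-1}^j}$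 is the column vector with components $\frac{\partial\phi_{i-1}^r}{\partial\theta_{i-1}^j}$, $r=1,\dots,k+1$; $Z_0=\sum_{r=1}^{k+1}\phi_0^r\frac{\partial}{\partial x^r}$ and $Z_i=\sum_{j=1}^k B_i^j\frac{\partial}{\partial\theta_{i-1}^j}$ for $i=1,\dots,n$; $X_m^i=\frac{\partial}{\partial\theta_m^i}$ for $i=1,\dots,k$, $m=0,\dots,n$; $X_m^0=\sum_{i=0}^m f_m^i Z_i$ for $m=0,\dots,n$, with $f_m^r=\prod_{j=r+1}^m A_j$ for $r=0,\dots,m-1$, and $f_m^m=1$. $\Delta_n$ is the distribution generated by $X_n^0,X_n^1,\dots,X_n^k$.
   Formalization: For j ≥ 2 the coefficient B_i^j is normalized by the square of the norm of ∂φ_{i-1}/∂θ_{i-1}^j instead of the norm itself; with the printed factor both (1) and (2) fail for k ≥ 2 (e.g. k=2, n=1, θ_0=(π/6,0)). *)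

theory Defs
  imports "HOL-Analysis.Analysis"
begin

section \<open>Numbered coordinates\<close>

text \<open>
  The arm has points \<open>M\<^sub>0, \<dots>, M\<^sub>n\<^sub>+\<^sub>1\<close> in the space of coordinates \<open>1, \<dots>, k+1\<close>.  The configuration
  space lives in \<open>(real ^ 'm) ^ 'p\<close> where \<open>CARD('m) = k + 1\<close> and \<open>CARD('p) = n + 2\<close>.  The class
  \<^class>\<open>enum\<close> equips a finite index type with a list of its elements; it is used only as a
  numbering of the indices.  Every finite cardinality is realised by such a type (for instance by
  the numeral types).
\<close>

definition ix :: "nat \<Rightarrow> 'a::enum" where
  "ix i = enum_class.enum ! i"

definition index_of :: "'a::enum \<Rightarrow> nat" where
  "index_of = inv_into {..<CARD('a)} ix"

lemma bij_betw_ix: "bij_betw (ix :: nat \<Rightarrow> 'a::enum) {..<CARD('a)} UNIV"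
proof -
  have len: "length (enum_class.enum :: 'a list) = CARD('a)"
    using distinct_card[OF enum_distinct[where ?'a = 'a]] by (simp add: UNIV_enum[symmetric])
  have "bij_betw ((!) (enum_class.enum :: 'a list)) {..<CARD('a)} UNIV"
    by (rule bij_betw_nth) (simp_all add: enum_distinct len UNIV_enum[symmetric])
  then show ?thesis
    by (simp add: ix_def[abs_def])
qed

lemma ix_index_of: "ix (index_of a) = a"
  and index_of_less: "index_of (a::'a::enum) < CARD('a)"
proof -
  have "a \<in> (ix :: nat \<Rightarrow> 'a) ` {..<CARD('a)}"
    using bij_betw_ix[where ?'a = 'a] by (simp add: bij_betw_def)
  then show "ix (index_of a) = a" "index_of a < CARD('a)"
    unfolding index_of_def using f_inv_into_f[of a ix] inv_into_into[of a ix "{..<CARD('a)}"]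
    by auto
qed

lemma index_of_ix: "i < CARD('a) \<Longrightarrow> index_of (ix i :: 'a::enum) = i"
  unfolding index_of_def using bij_betw_ix[where ?'a = 'a] by (simp add: bij_betw_def inv_into_f_f)

text \<open>Points are numbered from \<open>0\<close>, coordinates in \<open>\<real>\<^sup>k\<^sup>+\<^sup>1\<close> from \<open>1\<close>.\<close>

definition pt :: "('b ^ 'p::enum) \<Rightarrow> nat \<Rightarrow> 'b" where
  "pt q i = q $ ix i"

definition of_pts :: "(nat \<Rightarrow> 'b) \<Rightarrow> 'b ^ 'p::enum" where
  "of_pts f = (\<chi> a. f (index_of a))"

definition co :: "(real ^ 'm::enum) \<Rightarrow> nat \<Rightarrow> real" where
  "co x r = x $ ix (r - 1)"

definition of_cos :: "(nat \<Rightarrow> real) \<Rightarrow> real ^ 'm::enum" where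
  "of_cos f = (\<chi> a. f (index_of a + 1))"

definition unit_vec :: "nat \<Rightarrow> real ^ 'm::enum" where
  "unit_vec r = axis (ix (r - 1)) 1"

section \<open>Tangent spaces, distributions, projections\<close>

text \<open>Velocities at \<open>p\<close> of the \<open>C\<^sup>1\<close> curves drawn on \<open>M\<close>.\<close>

definition tangent_space :: "'a::real_normed_vector set \<Rightarrow> 'a \<Rightarrow> 'a set" where
  "tangent_space M p = {v. \<exists>\<epsilon>>0. \<exists>\<gamma>. \<gamma> C1_differentiable_on {-\<epsilon><..<\<epsilon>} \<and>
      \<gamma> ` {-\<epsilon><..<\<epsilon>} \<subseteq> M \<and> \<gamma> 0 = p \<and> (\<gamma> has_vector_derivative v) (at 0)}"

text \<open>
  A distribution assigns to a point the set of its vectors there.  For \<open>p\<close> outside \<open>F ` M\<close> the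
  image below is empty, so equating it with a linear subspace also asserts \<open>p \<in> F ` M\<close>.
\<close>

definition image_distribution ::
  "('a::real_normed_vector \<Rightarrow> 'b::real_normed_vector) \<Rightarrow> 'a set \<Rightarrow> ('a \<Rightarrow> 'a set) \<Rightarrow> 'b \<Rightarrow> 'b set" where
  "image_distribution F M D p = (\<Union>q \<in> {q \<in> M. F q = p}. frechet_derivative F (at q) ` D q)"

definition is_orth_proj :: "'a::real_inner set \<Rightarrow> 'a \<Rightarrow> 'a \<Rightarrow> bool" where
  "is_orth_proj W v w \<longleftrightarrow> w \<in> W \<and> (\<forall>u\<in>W. orthogonal (v - w) u)"

definition is_basis_of :: "(nat \<Rightarrow> 'a::real_vector) \<Rightarrow> nat set \<Rightarrow> 'a set \<Rightarrow> bool" where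
  "is_basis_of b J W \<longleftrightarrow> inj_on b J \<and> independent (b ` J) \<and> span (b ` J) = W"

section \<open>The articulated arm\<close>

type_synonym ('m, 'p) arm = "(real ^ 'm) ^ 'p"

definition Conf :: "nat \<Rightarrow> ('m::enum, 'p::enum) arm set" where
  "Conf n = {q. \<forall>i\<in>{0..n}. (norm (pt q i - pt q (i + 1)))\<^sup>2 - 1 = 0}"

text \<open>The constant field \<open>\<partial>/\<partial>x\<^sub>i\<^sup>r\<close> on the ambient space.\<close>

definition d_pt :: "nat \<Rightarrow> nat \<Rightarrow> ('m::enum, 'p::enum) arm" where
  "d_pt i r = axis (ix i) (unit_vec r)"

definition ZZ :: "nat \<Rightarrow> nat \<Rightarrow> ('m::enum, 'p::enum) arm \<Rightarrow> ('m::enum, 'p::enum) arm" where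
  "ZZ k i q = (\<Sum>r=1..k+1. (co (pt q (i + 1)) r - co (pt q i) r) *\<^sub>R d_pt i r)"

definition EE :: "nat \<Rightarrow> nat \<Rightarrow> ('m::enum, 'p::enum) arm \<Rightarrow> ('m::enum, 'p::enum) arm set" where
  "EE k n q = span ((\<lambda>i. ZZ k i q) ` {0..n} \<union> d_pt (n + 1) ` {1..k+1})"

definition Delta :: "nat \<Rightarrow> nat \<Rightarrow> ('m::enum, 'p::enum) arm \<Rightarrow> ('m::enum, 'p::enum) arm set" where
  "Delta k n q = tangent_space (Conf n) q \<inter> EE k n q"

text \<open>
  A motion \<open>q\<close> on a time interval \<open>I\<close>; \<open>u i\<close> for \<open>i \<le> n\<close> are the controls of \<open>ZZ\<close>, and \<open>w r\<close>
  those of \<open>\<partial>/\<partial>x\<^sub>n\<^sub>+\<^sub>1\<^sup>r\<close>.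
\<close>

definition kinematic_evolution ::
  "nat \<Rightarrow> nat \<Rightarrow> real set \<Rightarrow> (real \<Rightarrow> ('m::enum, 'p::enum) arm) \<Rightarrow> bool" where
  "kinematic_evolution k n I q \<longleftrightarrow> (\<forall>t\<in>I. q t \<in> Conf n) \<and>
     (\<exists>u w. \<forall>t\<in>I. (q has_vector_derivative
        ((\<Sum>i=0..n. u i t *\<^sub>R ZZ k i (q t)) + (\<Sum>r=1..k+1. w r t *\<^sub>R d_pt (n + 1) r)))
        (at t within I))"

section \<open>The space \<open>\<S>\<close> and its hyperspherical charts\<close>

text \<open>\<open>\<S>\<close> sits in the same ambient space, a point being written \<open>(x\<^sub>0, z\<^sub>1, \<dots>, z\<^sub>n\<^sub>+\<^sub>1)\<close>.\<close>

definition SS :: "nat \<Rightarrow> ('m::enum, 'p::enum) arm set" where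
  "SS n = {p. \<forall>i\<in>{1..n+1}. pt p i \<in> sphere 0 1}"

definition Gam :: "('m::enum, 'p::enum) arm \<Rightarrow> ('m::enum, 'p::enum) arm" where
  "Gam q = of_pts (\<lambda>i. if i = 0 then pt q 0 else pt q i - pt q (i - 1))"

type_synonym angles = "nat \<Rightarrow> nat \<Rightarrow> real"
type_synonym 'm charts = "nat \<Rightarrow> (nat \<Rightarrow> real) \<Rightarrow> real ^ 'm"

text \<open>The angles are \<open>\<theta> 1, \<dots>, \<theta> k\<close>; other values of \<open>\<theta>\<close> are irrelevant.\<close>

definition hyper :: "nat \<Rightarrow> (nat \<Rightarrow> real) \<Rightarrow> real ^ 'm::enum" where
  "hyper k \<theta> = of_cos (\<lambda>r. (\<Prod>j=1..k+1-r. sin (\<theta> j)) * (if r = 1 then 1 else cos (\<theta> (k + 2 - r))))"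

text \<open>
  Hyperspherical coordinates with respect to an arbitrary orthonormal frame of \<open>\<real>\<^sup>k\<^sup>+\<^sup>1\<close>, such that
  the zero angles give \<open>\<alpha>\<close>.
\<close>

definition hyper_chart :: "nat \<Rightarrow> real ^ 'm::enum \<Rightarrow> ((nat \<Rightarrow> real) \<Rightarrow> real ^ 'm::enum) \<Rightarrow> bool" where
  "hyper_chart k \<alpha> \<Phi> \<longleftrightarrow>
     (\<exists>R :: real ^ 'm::enum \<Rightarrow> real ^ 'm::enum. orthogonal_transformation R \<and> \<Phi> = (\<lambda>\<theta>. R (hyper k \<theta>))) \<and> \<Phi> (\<lambda>_. 0) = \<alpha>"

definition hyper_charts :: "nat \<Rightarrow> nat \<Rightarrow> 'm::enum charts \<Rightarrow> bool" where
  "hyper_charts k n \<Phi> \<longleftrightarrow> (\<forall>i\<in>{0..n}. \<exists>\<alpha>\<in>sphere 0 1. hyper_chart k \<alpha> (\<Phi> i))"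

definition angle_dom :: "nat \<Rightarrow> nat \<Rightarrow> angles set" where
  "angle_dom k n = {\<theta>. \<forall>i\<in>{0..n}. 0 \<le> \<theta> i k \<and> \<theta> i k \<le> 2 * pi \<and>
      (\<forall>j\<in>{1..<k}. 0 < \<theta> i j \<and> \<theta> i j < pi)}"

text \<open>The point of \<open>\<S>\<close> with coordinates \<open>(x, \<theta>\<^sub>0, \<dots>, \<theta>\<^sub>n)\<close>.\<close>

definition chart_pt ::
  "'m::enum charts \<Rightarrow> real ^ 'm::enum \<Rightarrow> angles \<Rightarrow> ('m::enum, 'p::enum) arm" where
  "chart_pt \<Phi> x \<theta> = of_pts (\<lambda>i. if i = 0 then x else \<Phi> (i - 1) (\<theta> (i - 1)))"

text \<open>
  Coordinate vector fields of the chart, as vectors of the ambient space tangent to \<open>\<S>\<close> at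
  \<open>chart_pt \<Phi> x \<theta>\<close>.
\<close>

definition d_x ::
  "'m::enum charts \<Rightarrow> real ^ 'm::enum \<Rightarrow> angles \<Rightarrow> nat \<Rightarrow> ('m::enum, 'p::enum) arm" where
  "d_x \<Phi> x \<theta> r = vector_derivative (\<lambda>s. chart_pt \<Phi> (x + s *\<^sub>R unit_vec r) \<theta>) (at 0)"

definition d_theta ::
  "'m::enum charts \<Rightarrow> real ^ 'm::enum \<Rightarrow> angles \<Rightarrow> nat \<Rightarrow> nat \<Rightarrow> ('m::enum, 'p::enum) arm" where
  "d_theta \<Phi> x \<theta> i j = vector_derivative (\<lambda>s. chart_pt \<Phi> x (\<theta>(i := (\<theta> i)(j := s)))) (at (\<theta> i j))"

section \<open>The distribution \<open>\<Delta>\<^sub>n\<close>\<close>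

definition d_phi :: "((nat \<Rightarrow> real) \<Rightarrow> real ^ 'm::enum) \<Rightarrow> (nat \<Rightarrow> real) \<Rightarrow> nat \<Rightarrow> nat \<Rightarrow> real" where
  "d_phi \<phi> \<theta> j r = deriv (\<lambda>s. co (\<phi> (\<theta>(j := s))) r) (\<theta> j)"

definition A_fun ::
  "nat \<Rightarrow> nat \<Rightarrow> 'm::enum charts \<Rightarrow> angles \<Rightarrow> nat \<Rightarrow> real" where
  "A_fun k n \<Phi> \<theta> i = (if i = n + 1 then 1
     else (\<Sum>r=1..k+1. co (\<Phi> (i - 1) (\<theta> (i - 1))) r * co (\<Phi> i (\<theta> i)) r))"

text \<open>
  For \<open>j \<ge> 2\<close> the normalisation is by the square of the norm of \<open>\<partial>\<phi>\<^sub>i\<^sub>-\<^sub>1/\<partial>\<theta>\<^sub>i\<^sub>-\<^sub>1\<^sup>j\<close>.  The source prints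
  the norm itself; with that factor both the image of \<open>\<Delta>\<close> and the controlled system are wrong
  as soon as \<open>k \<ge> 2\<close>, because the coordinate fields \<open>\<partial>/\<partial>\<theta>\<^sub>i\<^sup>j\<close> that \<open>B_fun\<close> multiplies are orthogonal
  but not of unit length: the coefficient of a vector \<open>v\<close> on \<open>e\<close> in an orthogonal basis is
  \<open>\<langle>v, e\<rangle> / \<parallel>e\<parallel>\<^sup>2\<close>.  For \<open>j = 1\<close> the norm is 1.
\<close>

definition B_fun ::
  "nat \<Rightarrow> 'm::enum charts \<Rightarrow> angles \<Rightarrow> nat \<Rightarrow> nat \<Rightarrow> real" where
  "B_fun k \<Phi> \<theta> i j =
     (let d = d_phi (\<Phi> (i - 1)) (\<theta> (i - 1)) j;
          s = (\<Sum>r=1..k+1. d r * co (\<Phi> i (\<theta> i)) r)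
      in if j = 1 then s else s / (norm (of_cos d :: real ^ 'm::enum))\<^sup>2)"

definition Z_field ::
  "nat \<Rightarrow> 'm::enum charts \<Rightarrow> real ^ 'm::enum \<Rightarrow> angles \<Rightarrow> nat \<Rightarrow> ('m::enum, 'p::enum) arm" where
  "Z_field k \<Phi> x \<theta> i =
     (if i = 0 then (\<Sum>r=1..k+1. co (\<Phi> 0 (\<theta> 0)) r *\<^sub>R d_x \<Phi> x \<theta> r)
      else (\<Sum>j=1..k. B_fun k \<Phi> \<theta> i j *\<^sub>R d_theta \<Phi> x \<theta> (i - 1) j))"

definition f_fun ::
  "nat \<Rightarrow> nat \<Rightarrow> 'm::enum charts \<Rightarrow> angles \<Rightarrow> nat \<Rightarrow> nat \<Rightarrow> real" where
  "f_fun k n \<Phi> \<theta> m r = (if r = m then 1 else (\<Prod>j=r+1..m. A_fun k n \<Phi> \<theta> j))"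

definition X_field ::
  "nat \<Rightarrow> nat \<Rightarrow> 'm::enum charts \<Rightarrow> real ^ 'm::enum \<Rightarrow> angles \<Rightarrow> nat \<Rightarrow> nat \<Rightarrow>
     ('m::enum, 'p::enum) arm" where
  "X_field k n \<Phi> x \<theta> m i =
     (if i = 0 then (\<Sum>r=0..m. f_fun k n \<Phi> \<theta> m r *\<^sub>R Z_field k \<Phi> x \<theta> r) else d_theta \<Phi> x \<theta> m i)"

text \<open>The value of \<open>\<Delta>\<^sub>n\<close> at \<open>chart_pt \<Phi> x \<theta>\<close>, computed in that chart.\<close>

definition Delta_n ::
  "nat \<Rightarrow> nat \<Rightarrow> 'm::enum charts \<Rightarrow> real ^ 'm::enum \<Rightarrow> angles \<Rightarrow>
     ('m::enum, 'p::enum) arm set" where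
  "Delta_n k n \<Phi> x \<theta> = span (X_field k n \<Phi> x \<theta> n ` {0..k})"

section \<open>The controlled system and the moving frames\<close>

definition vel ::
  "nat \<Rightarrow> nat \<Rightarrow> 'm::enum charts \<Rightarrow> angles \<Rightarrow> real \<Rightarrow> nat \<Rightarrow> real" where
  "vel k n \<Phi> \<theta> vn i = vn * (\<Prod>r=i+1..n. A_fun k n \<Phi> \<theta> r)"

text \<open>The controls are the functions \<open>vt 1, \<dots>, vt k\<close> (one for each \<open>\<theta>\<^sub>n\<^sup>j\<close>) and \<open>vn\<close> of time.\<close>

definition controlled_system ::
  "nat \<Rightarrow> nat \<Rightarrow> 'm::enum charts \<Rightarrow> real set \<Rightarrow>
     (real \<Rightarrow> real ^ 'm::enum) \<Rightarrow> (real \<Rightarrow> angles) \<Rightarrow> (nat \<Rightarrow> real \<Rightarrow> real) \<Rightarrow> (real \<Rightarrow> real) \<Rightarrow> bool" where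
  "controlled_system k n \<Phi> I x \<theta> vt vn \<longleftrightarrow> (\<forall>t\<in>I.
     (\<forall>r\<in>{1..k+1}. ((\<lambda>s. co (x s) r) has_real_derivative
        vel k n \<Phi> (\<theta> t) (vn t) 0 * co (\<Phi> 0 (\<theta> t 0)) r) (at t within I)) \<and>
     (\<forall>i<n. \<forall>j\<in>{1..k}. ((\<lambda>s. \<theta> s i j) has_real_derivative
        vel k n \<Phi> (\<theta> t) (vn t) (i + 1) * B_fun k \<Phi> (\<theta> t) (i + 1) j) (at t within I)) \<and>
     (\<forall>j\<in>{1..k}. ((\<lambda>s. \<theta> s n j) has_real_derivative vt j t) (at t within I)))"

text \<open>
  Image of the canonical frame under the differential of \<open>(\<rho>, \<theta>) \<mapsto> \<rho> \<phi>(\<theta>) + c\<close> at \<open>\<rho> = 1\<close>, that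
  is, at the point \<open>\<phi>(\<theta>) + c\<close> of the unit sphere of centre \<open>c\<close>.
\<close>

definition nu_frame :: "((nat \<Rightarrow> real) \<Rightarrow> real ^ 'm::enum) \<Rightarrow> real ^ 'm::enum \<Rightarrow> (nat \<Rightarrow> real) \<Rightarrow> real ^ 'm::enum" where
  "nu_frame \<phi> c \<theta> = vector_derivative (\<lambda>\<rho>. \<rho> *\<^sub>R \<phi> \<theta> + c) (at 1)"

definition Theta_frame ::
  "((nat \<Rightarrow> real) \<Rightarrow> real ^ 'm::enum) \<Rightarrow> real ^ 'm::enum \<Rightarrow> (nat \<Rightarrow> real) \<Rightarrow> nat \<Rightarrow> real ^ 'm::enum" where
  "Theta_frame \<phi> c \<theta> j = vector_derivative (\<lambda>s. 1 *\<^sub>R \<phi> (\<theta>(j := s)) + c) (at (\<theta> j))"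

end

theory Submission
  imports Defs
begin

text \<open>
  The links \<open>z\<^sub>i = x\<^sub>i\<^sub>+\<^sub>1 - x\<^sub>i = \<phi>\<^sub>i(\<theta>\<^sub>i)\<close> stay on unit spheres, so an admissible velocity \<open>v\<close> is one with
  \<open>v\<^sub>i = u\<^sub>i z\<^sub>i\<close> for \<open>i \<le> n\<close> and \<open>v\<^sub>i\<^sub>+\<^sub>1 - v\<^sub>i\<close> orthogonal to \<open>z\<^sub>i\<close>.  Taking inner products with \<open>z\<^sub>i\<close> turns
  this into \<open>u\<^sub>i = A\<^sub>i\<^sub>+\<^sub>1 u\<^sub>i\<^sub>+\<^sub>1\<close>, whence \<open>u\<^sub>i\<close> is \<open>u\<^sub>n\<close> times the product of the \<open>A\<^sub>r\<close>, and
  \<open>v\<^sub>i\<^sub>+\<^sub>1 - v\<^sub>i = u\<^sub>i\<^sub>+\<^sub>1 (z\<^sub>i\<^sub>+\<^sub>1 - A\<^sub>i\<^sub>+\<^sub>1 z\<^sub>i)\<close>.  The bracket is the projection of \<open>z\<^sub>i\<^sub>+\<^sub>1\<close> to the tangent space at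
  \<open>z\<^sub>i\<close>; its coordinates in the orthogonal basis \<open>\<partial>\<phi>\<^sub>i/\<partial>\<theta>\<^sub>i\<^sup>j\<close> are the \<open>B\<^sub>i\<^sub>+\<^sub>1\<^sup>j\<close>.  For motions one also needs
  that the angles are differentiable as soon as the links are: \<open>sin \<theta>\<^sup>1 \<cdots> sin \<theta>\<^sup>j\<^sup>-\<^sup>1 cos \<theta>\<^sup>j\<close> is a coordinate
  of \<open>\<phi>(\<theta>)\<close>, so the angles can be solved for one after the other.
\<close>

section \<open>Numbered coordinates\<close>

lemma pt_of_pts: "i < CARD('p) \<Longrightarrow> pt (of_pts f :: 'b ^ 'p::enum) i = f i"
  by (simp add: pt_def of_pts_def index_of_ix)

lemma arm_eqI:
  fixes p q :: "'b ^ 'p::enum"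
  assumes "\<And>i. i < CARD('p) \<Longrightarrow> pt p i = pt q i"
  shows "p = q"
  unfolding vec_eq_iff
proof
  fix a :: 'p
  show "p $ a = q $ a"
    using assms[OF index_of_less[of a]] by (simp add: pt_def ix_index_of)
qed

lemma bounded_linear_pt: "bounded_linear (\<lambda>q :: 'b::real_normed_vector ^ 'p::enum. pt q i)"
  unfolding pt_def by (rule bounded_linear_vec_nth)

lemma pt_add: "pt (p + q) i = pt p i + pt q i"
  and pt_diff: "pt (p' - q') i = pt p' i - pt q' i"
  and pt_scaleR: "pt (c *\<^sub>R r) i = c *\<^sub>R pt r i"
  and pt_zero: "pt 0 i = 0"
  by (simp_all add: pt_def)

lemma pt_sum: "pt (\<Sum>a\<in>A. f a) i = (\<Sum>a\<in>A. pt (f a) i)"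
  by (simp add: pt_def sum_component)

lemmas pt_linear = pt_add pt_diff pt_scaleR pt_zero pt_sum

lemma ix_eq_iff: "i < CARD('a) \<Longrightarrow> j < CARD('a) \<Longrightarrow> (ix i :: 'a::enum) = ix j \<longleftrightarrow> i = j"
  by (metis index_of_ix)

lemma pt_axis:
  "i < CARD('p) \<Longrightarrow> j < CARD('p) \<Longrightarrow> pt (axis (ix i) v :: 'b::zero ^ 'p::enum) j = (if i = j then v else 0)"
  by (simp add: pt_def axis_def ix_eq_iff)

lemma bounded_linear_axis: "bounded_linear (axis a :: 'b::real_normed_vector \<Rightarrow> 'b ^ 'p::finite)"
proof (rule bounded_linear_intro[where K = 1])
  show "norm (axis a x :: 'b ^ 'p::finite) \<le> norm x * 1" for x :: 'b
    by (simp add: norm_vec_def L2_set_def axis_def if_distrib[of norm] if_distrib[of "\<lambda>y. y\<^sup>2"] cong: if_cong)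
qed (auto simp: axis_def vec_eq_iff)

lemma sum_over_ix: "(\<Sum>a\<in>UNIV. f (a :: 'a::enum)) = (\<Sum>i<CARD('a). f (ix i))"
  using sum.reindex_bij_betw[OF bij_betw_ix[where ?'a = 'a], of f] by simp

lemma sum_over_pred_ix: "(\<Sum>a\<in>UNIV. f (a :: 'a::enum)) = (\<Sum>r=1..CARD('a). f (ix (r - 1)))"
proof -
  have "(\<Sum>i<CARD('a). f (ix i)) = (\<Sum>r=1..CARD('a). f (ix (r - 1)))"
    by (rule sum.reindex_bij_witness[of _ "\<lambda>r. r - 1" Suc]) auto
  then show ?thesis by (simp add: sum_over_ix)
qed

section \<open>Calculus of motions, point by point\<close>

text \<open>An arm is the finite sum of its points placed by the bounded linear maps
  \<open>axis (ix i)\<close>, so derivatives of the points add up to one of the motion. Continuity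
  is assembled the same way below.\<close>

lemma has_vector_derivative_arm_iff:
  fixes q :: "real \<Rightarrow> 'b::real_normed_vector ^ 'p::enum"
  shows "(q has_vector_derivative v) F \<longleftrightarrow>
    (\<forall>i<CARD('p). ((\<lambda>s. pt (q s) i) has_vector_derivative pt v i) F)"
proof (intro iffI allI impI)
  show "((\<lambda>s. pt (q s) i) has_vector_derivative pt v i) F" if "(q has_vector_derivative v) F" for i
    by (rule bounded_linear.has_vector_derivative[OF bounded_linear_pt that])
next
  assume *: "\<forall>i<CARD('p). ((\<lambda>s. pt (q s) i) has_vector_derivative pt v i) F"
  have decomp: "p = (\<Sum>i<CARD('p). axis (ix i) (pt p i))" for p :: "'b ^ 'p::enum"
    by (rule arm_eqI) (simp add: pt_sum pt_axis sum.delta')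
  have "((\<lambda>s. \<Sum>i<CARD('p). axis (ix i) (pt (q s) i) :: 'b ^ 'p::enum) has_vector_derivative
      (\<Sum>i<CARD('p). axis (ix i) (pt v i))) F"
    using * by (intro has_vector_derivative_sum bounded_linear.has_vector_derivative[OF bounded_linear_axis]) auto
  then show "(q has_vector_derivative v) F"
    by (simp flip: decomp)
qed

lemma continuous_on_arm_iff:
  fixes q :: "real \<Rightarrow> 'b::real_normed_vector ^ 'p::enum"
  shows "continuous_on A q \<longleftrightarrow> (\<forall>i<CARD('p). continuous_on A (\<lambda>s. pt (q s) i))"
proof (intro iffI allI impI)
  show "continuous_on A (\<lambda>s. pt (q s) i)" if "continuous_on A q" for i
    using that by (intro bounded_linear.continuous_on[OF bounded_linear_pt])
next
  assume *: "\<forall>i<CARD('p). continuous_on A (\<lambda>s. pt (q s) i)"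
  have decomp: "p = (\<Sum>i<CARD('p). axis (ix i) (pt p i))" for p :: "'b ^ 'p::enum"
    by (rule arm_eqI) (simp add: pt_sum pt_axis sum.delta')
  have "continuous_on A (\<lambda>s. \<Sum>i<CARD('p). axis (ix i) (pt (q s) i) :: 'b ^ 'p::enum)"
    using * by (intro continuous_on_sum bounded_linear.continuous_on[OF bounded_linear_axis]) auto
  then show "continuous_on A q"
    by (simp flip: decomp)
qed

lemma co_of_cos: "1 \<le> r \<Longrightarrow> r \<le> CARD('m) \<Longrightarrow> co (of_cos f :: real ^ 'm::enum) r = f r"
  by (simp add: co_def of_cos_def index_of_ix)

lemma of_cos_co: "of_cos (co x) = x"
  by (simp add: vec_eq_iff of_cos_def co_def ix_index_of)

lemma of_cos_cong:
  "(\<And>r. 1 \<le> r \<Longrightarrow> r \<le> CARD('m) \<Longrightarrow> f r = g r) \<Longrightarrow> (of_cos f :: real ^ 'm::enum) = of_cos g"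
  by (simp add: of_cos_def vec_eq_iff Suc_le_eq index_of_less)

lemma inner_eq_sum_co: "(x :: real ^ 'm::enum) \<bullet> y = (\<Sum>r=1..CARD('m). co x r * co y r)"
  by (simp add: inner_vec_def sum_over_pred_ix co_def)

lemma sum_co_unit_vec: "(\<Sum>r=1..CARD('m). co x r *\<^sub>R unit_vec r) = (x :: real ^ 'm::enum)"
  using sum_over_pred_ix[of "\<lambda>a. x $ a *\<^sub>R (axis a 1 :: real ^ 'm::enum)"] basis_expansion[of x]
  by (simp add: co_def unit_vec_def scalar_mult_eq_scaleR)

lemma bounded_linear_co: "bounded_linear (\<lambda>x :: real ^ 'm::enum. co x r)"
  unfolding co_def by (rule bounded_linear_vec_nth)

lemma co_diff: "co (x - y) r = co x r - co y r"
  by (simp add: co_def)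

lemma has_vector_derivative_of_cos:
  assumes "\<And>r. 1 \<le> r \<Longrightarrow> r \<le> CARD('m) \<Longrightarrow> ((\<lambda>s. g s r) has_real_derivative d r) F"
  shows "((\<lambda>s. of_cos (g s) :: real ^ 'm::enum) has_vector_derivative of_cos d) F"
proof -
  have decomp: "of_cos f = (\<Sum>r=1..CARD('m). f r *\<^sub>R (unit_vec r :: real ^ 'm::enum))" for f
    using sum_co_unit_vec[of "of_cos f :: real ^ 'm::enum"] by (simp add: co_of_cos)
  have "((\<lambda>s. \<Sum>r=1..CARD('m). g s r *\<^sub>R (unit_vec r :: real ^ 'm::enum)) has_vector_derivative
      (\<Sum>r=1..CARD('m). d r *\<^sub>R unit_vec r)) F"
    using assms
    by (intro has_vector_derivative_sum bounded_linear.has_vector_derivative[OF bounded_linear_scaleR_left])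
      (auto simp: has_real_derivative_iff_has_vector_derivative)
  then show ?thesis
    by (simp add: decomp)
qed

section \<open>The hyperspherical frame\<close>

text \<open>
  The coordinate \<open>r\<close> of \<^const>\<open>hyper\<close> is \<open>tail_hyper k \<theta> 0 m\<close> with \<open>m = k + 1 - r\<close>, and its derivative in \<open>\<theta>\<^sup>j\<close>
  is \<open>sin_prod \<theta> 0 (j - 1) * frame_coeff k \<theta> j m\<close>.  The vectors \<open>frame_coeff k \<theta> j\<close> are orthonormal because
  \<open>tail_hyper k \<theta> i\<close> is again a point of a unit sphere, with angles \<open>\<theta>\<^sup>i\<^sup>+\<^sup>1, \<dots>, \<theta>\<^sup>k\<close>.
\<close>

definition sin_prod :: "(nat \<Rightarrow> real) \<Rightarrow> nat \<Rightarrow> nat \<Rightarrow> real" where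
  "sin_prod \<theta> i m = (\<Prod>l\<in>{i<..m}. sin (\<theta> l))"

definition tail_hyper :: "nat \<Rightarrow> (nat \<Rightarrow> real) \<Rightarrow> nat \<Rightarrow> nat \<Rightarrow> real" where
  "tail_hyper k \<theta> i m = sin_prod \<theta> i m * (if m = k then 1 else cos (\<theta> (m + 1)))"

text \<open>For \<open>m + 1 \<ge> j\<close> this is the partial derivative of
  \<open>tail_hyper k \<theta> (j - 1) m\<close> in angle \<open>j\<close>: first the cosine turns
  into minus the sine, then the leading sine into the cosine. Entries with \<open>m + 1 < j\<close>
  do not contain that angle.\<close>

definition frame_coeff :: "nat \<Rightarrow> (nat \<Rightarrow> real) \<Rightarrow> nat \<Rightarrow> nat \<Rightarrow> real" where
  "frame_coeff k \<theta> j m =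
     (if m + 1 < j then 0 else if m + 1 = j then - sin (\<theta> j) else cos (\<theta> j) * tail_hyper k \<theta> j m)"

lemma sin_prod_self [simp]: "sin_prod \<theta> i i = 1"
  by (simp add: sin_prod_def)

lemma sin_prod_Suc: "i \<le> m \<Longrightarrow> sin_prod \<theta> i (Suc m) = sin_prod \<theta> i m * sin (\<theta> (Suc m))"
proof -
  assume "i \<le> m"
  then have "{i<..Suc m} = insert (Suc m) {i<..m}" by auto
  then show ?thesis by (simp add: sin_prod_def mult.commute)
qed

lemma sin_prod_split: "i \<le> j \<Longrightarrow> j \<le> m \<Longrightarrow> sin_prod \<theta> i m = sin_prod \<theta> i j * sin_prod \<theta> j m"
proof -
  assume "i \<le> j" "j \<le> m"
  then have "{i<..m} = {i<..j} \<union> {j<..m}" by auto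
  then show ?thesis by (simp add: sin_prod_def prod.union_disjoint)
qed

lemma tail_hyper_split: "i \<le> j \<Longrightarrow> j \<le> m \<Longrightarrow> tail_hyper k \<theta> i m = sin_prod \<theta> i j * tail_hyper k \<theta> j m"
  by (simp add: tail_hyper_def sin_prod_split[of i j m])

lemma sin_prod_nonzero: "(\<And>j. 1 \<le> j \<Longrightarrow> j \<le> m \<Longrightarrow> sin (\<theta> j) \<noteq> 0) \<Longrightarrow> sin_prod \<theta> 0 m \<noteq> 0"
  by (auto simp: sin_prod_def)

section \<open>Orthonormality of the hyperspherical frame\<close>

text \<open>Descending on \<open>i\<close>, each new angle splits the sum as cosine squared plus
  sine squared times the previous sum.\<close>

lemma sum_tail_hyper_sq: "i \<le> k \<Longrightarrow> (\<Sum>m=i..k. (tail_hyper k \<theta> i m)\<^sup>2) = 1"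
proof (induction rule: inc_induct)
  case base
  then show ?case by (simp add: tail_hyper_def)
next
  case (step i)
  have "(\<Sum>m=i..k. (tail_hyper k \<theta> i m)\<^sup>2) =
      (tail_hyper k \<theta> i i)\<^sup>2 + (\<Sum>m=Suc i..k. (tail_hyper k \<theta> i m)\<^sup>2)"
    using step.hyps by (simp add: sum.atLeast_Suc_atMost)
  also have "(\<Sum>m=Suc i..k. (tail_hyper k \<theta> i m)\<^sup>2) =
      (sin (\<theta> (Suc i)))\<^sup>2 * (\<Sum>m=Suc i..k. (tail_hyper k \<theta> (Suc i) m)\<^sup>2)"
    by (simp add: sum_distrib_left tail_hyper_split[of i "Suc i"] sin_prod_Suc power_mult_distrib)
  also have "tail_hyper k \<theta> i i = cos (\<theta> (Suc i))"
    using step.hyps by (simp add: tail_hyper_def)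
  finally show ?case
    using step.IH by simp
qed

text \<open>Every inner product with frame vector \<open>j\<close> reduces to one entry at
  \<open>j - 1\<close> and a sum against the unit vector
  \<open>tail_hyper k \<theta> j\<close>.\<close>

lemma sum_frame_coeff_split:
  assumes "1 \<le> j" "j \<le> k"
  shows "(\<Sum>m\<le>k. g m * frame_coeff k \<theta> j m) =
    - sin (\<theta> j) * g (j - 1) + cos (\<theta> j) * (\<Sum>m=j..k. g m * tail_hyper k \<theta> j m)"
proof -
  have split: "(\<Sum>m\<le>k. h m) = (\<Sum>m<j - 1. h m) + h (j - 1) + (\<Sum>m=j..k. h m)" for h :: "nat \<Rightarrow> real"
  proof -
    have "{..k} = {..<j - 1} \<union> {j - 1} \<union> {j..k}" using assms by auto
    moreover have "{..<j - 1} \<inter> {j..k} = {}" by auto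
    ultimately show ?thesis using assms by (simp add: sum.union_disjoint)
  qed
  have "(\<Sum>m<j - 1. g m * frame_coeff k \<theta> j m) = 0"
    by (rule sum.neutral) (auto simp: frame_coeff_def)
  moreover have "(\<Sum>m=j..k. g m * frame_coeff k \<theta> j m) = cos (\<theta> j) * (\<Sum>m=j..k. g m * tail_hyper k \<theta> j m)"
    by (auto simp: frame_coeff_def sum_distrib_left intro!: sum.cong)
  moreover have "frame_coeff k \<theta> j (j - 1) = - sin (\<theta> j)"
    using assms by (simp add: frame_coeff_def)
  ultimately show ?thesis
    unfolding split[of "\<lambda>m. g m * frame_coeff k \<theta> j m"] by simp
qed

text \<open>With P the product of \<open>c\<close> and \<open>sin_prod \<theta> i (j - 1)\<close>,
  the entry at \<open>j - 1\<close> contributes minus P sin cos of angle \<open>j\<close>. The tail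
  contributes the opposite, because its squares sum to one.\<close>

lemma tail_hyper_frame_orthogonal:
  assumes "i < j" "j \<le> k"
  shows "(\<Sum>m\<le>k. (c * tail_hyper k \<theta> i m) * frame_coeff k \<theta> j m) = 0"
proof -
  have "tail_hyper k \<theta> i (j - 1) = sin_prod \<theta> i (j - 1) * cos (\<theta> j)"
    using assms by (simp add: tail_hyper_def)
  moreover have "sin_prod \<theta> i j = sin_prod \<theta> i (j - 1) * sin (\<theta> j)"
    using sin_prod_Suc[of i "j - 1" \<theta>] assms by simp
  moreover have "(\<Sum>m=j..k. c * tail_hyper k \<theta> i m * tail_hyper k \<theta> j m) =
      c * sin_prod \<theta> i j * (\<Sum>m=j..k. (tail_hyper k \<theta> j m)\<^sup>2)"
    using assms by (simp add: sum_distrib_left tail_hyper_split[of i j] power2_eq_square mult.assoc)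
  ultimately show ?thesis
    using assms sum_tail_hyper_sq[of j k \<theta>] by (subst sum_frame_coeff_split) auto
qed

text \<open>Wherever vector \<open>j\<close> is nonzero one has \<open>m \<ge> i\<close>, and there
  vector \<open>i\<close> is \<open>cos (\<theta> i)\<close> times
  \<open>tail_hyper k \<theta> i\<close>.\<close>

lemma frame_coeff_orthogonal:
  assumes "1 \<le> i" "i < j" "j \<le> k"
  shows "(\<Sum>m\<le>k. frame_coeff k \<theta> i m * frame_coeff k \<theta> j m) = 0"
proof -
  have "(\<Sum>m\<le>k. frame_coeff k \<theta> i m * frame_coeff k \<theta> j m) =
      (\<Sum>m\<le>k. (cos (\<theta> i) * tail_hyper k \<theta> i m) * frame_coeff k \<theta> j m)"
    using assms by (intro sum.cong) (auto simp: frame_coeff_def)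
  then show ?thesis
    using tail_hyper_frame_orthogonal assms by simp
qed

lemma sum_frame_coeff_sq:
  assumes "1 \<le> j" "j \<le> k"
  shows "(\<Sum>m\<le>k. frame_coeff k \<theta> j m * frame_coeff k \<theta> j m) = 1"
proof -
  have "(\<Sum>m=j..k. frame_coeff k \<theta> j m * tail_hyper k \<theta> j m) =
      cos (\<theta> j) * (\<Sum>m=j..k. (tail_hyper k \<theta> j m)\<^sup>2)"
    by (auto simp: frame_coeff_def sum_distrib_left power2_eq_square intro!: sum.cong)
  then show ?thesis
    using assms sum_tail_hyper_sq[of j k \<theta>]
    by (subst sum_frame_coeff_split) (auto simp: frame_coeff_def simp flip: power2_eq_square)
qed

section \<open>Differentiating the hyperspherical coordinates\<close>

lemma has_real_derivative_sin_prod: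
  assumes "\<And>j. 1 \<le> j \<Longrightarrow> j \<le> m \<Longrightarrow> ((\<lambda>s. \<theta> s j) has_real_derivative a j) (at t within I)"
  shows "((\<lambda>s. sin_prod (\<theta> s) 0 m) has_real_derivative
    (\<Sum>j=1..m. a j * (sin_prod (\<theta> t) 0 (j - 1) * cos (\<theta> t j) * sin_prod (\<theta> t) j m))) (at t within I)"
  using assms
proof (induction m)
  case 0
  then show ?case by simp
next
  case (Suc m)
  have "((\<lambda>s. sin_prod (\<theta> s) 0 m * sin (\<theta> s (Suc m))) has_real_derivative
      (\<Sum>j=1..m. a j * (sin_prod (\<theta> t) 0 (j - 1) * cos (\<theta> t j) * sin_prod (\<theta> t) j m)) * sin (\<theta> t (Suc m)) +
      cos (\<theta> t (Suc m)) * a (Suc m) * sin_prod (\<theta> t) 0 m) (at t within I)"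
    by (rule derivative_eq_intros Suc refl | simp)+
  moreover have "(\<Sum>j=1..m. a j * (sin_prod (\<theta> t) 0 (j - 1) * cos (\<theta> t j) * sin_prod (\<theta> t) j m)) * sin (\<theta> t (Suc m))
      = (\<Sum>j=1..m. a j * (sin_prod (\<theta> t) 0 (j - 1) * cos (\<theta> t j) * sin_prod (\<theta> t) j (Suc m)))"
    by (auto simp: sum_distrib_right sin_prod_Suc intro!: sum.cong)
  ultimately show ?case
    by (simp add: sin_prod_Suc algebra_simps)
qed

text \<open>The Leibniz rule with the sum extended to all \<open>k\<close> angles, so that the same
  index set serves every coordinate; the zeros of \<open>frame_coeff\<close> absorb the angles that
  do not occur. The case \<open>m = k\<close> is apart because that coordinate has no cosine
  factor.\<close>

lemma has_real_derivative_tail_hyper: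
  assumes "\<And>j. 1 \<le> j \<Longrightarrow> j \<le> k \<Longrightarrow> ((\<lambda>s. \<theta> s j) has_real_derivative a j) (at t within I)" "m \<le> k"
  shows "((\<lambda>s. tail_hyper k (\<theta> s) 0 m) has_real_derivative
    (\<Sum>j=1..k. a j * (sin_prod (\<theta> t) 0 (j - 1) * frame_coeff k (\<theta> t) j m))) (at t within I)"
proof (cases "m = k")
  case True
  have "((\<lambda>s. sin_prod (\<theta> s) 0 m) has_real_derivative
    (\<Sum>j=1..m. a j * (sin_prod (\<theta> t) 0 (j - 1) * cos (\<theta> t j) * sin_prod (\<theta> t) j m))) (at t within I)"
    using assms by (intro has_real_derivative_sin_prod) auto
  moreover have "(\<Sum>j=1..m. a j * (sin_prod (\<theta> t) 0 (j - 1) * cos (\<theta> t j) * sin_prod (\<theta> t) j m)) =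
      (\<Sum>j=1..k. a j * (sin_prod (\<theta> t) 0 (j - 1) * frame_coeff k (\<theta> t) j m))"
    using True by (intro sum.cong) (auto simp: frame_coeff_def tail_hyper_def)
  ultimately show ?thesis
    by (simp add: tail_hyper_def True)
next
  case False
  then have m: "m < k" using assms by simp
  have prod: "((\<lambda>s. sin_prod (\<theta> s) 0 m) has_real_derivative
    (\<Sum>j=1..m. a j * (sin_prod (\<theta> t) 0 (j - 1) * cos (\<theta> t j) * sin_prod (\<theta> t) j m))) (at t within I)"
    using assms by (intro has_real_derivative_sin_prod) auto
  have last: "((\<lambda>s. \<theta> s (Suc m)) has_real_derivative a (Suc m)) (at t within I)"
    using assms m by auto
  have "((\<lambda>s. sin_prod (\<theta> s) 0 m * cos (\<theta> s (Suc m))) has_real_derivative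
    (\<Sum>j=1..m. a j * (sin_prod (\<theta> t) 0 (j - 1) * cos (\<theta> t j) * sin_prod (\<theta> t) j m)) * cos (\<theta> t (Suc m))
     + - sin (\<theta> t (Suc m)) * a (Suc m) * sin_prod (\<theta> t) 0 m) (at t within I)"
    by (rule derivative_eq_intros prod last refl | simp)+
  moreover have "(\<Sum>j=1..k. a j * (sin_prod (\<theta> t) 0 (j - 1) * frame_coeff k (\<theta> t) j m)) =
     (\<Sum>j=1..m. a j * (sin_prod (\<theta> t) 0 (j - 1) * cos (\<theta> t j) * sin_prod (\<theta> t) j m)) * cos (\<theta> t (Suc m))
     + - sin (\<theta> t (Suc m)) * a (Suc m) * sin_prod (\<theta> t) 0 m"
  proof -
    \<comment> \<open>Angles under a sine, the angle under the cosine, and absent angles.\<close>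
    have set: "{1..k} = {1..m} \<union> {Suc m} \<union> {Suc (Suc m)..k}" using m by auto
    have "(\<Sum>j=Suc (Suc m)..k. a j * (sin_prod (\<theta> t) 0 (j - 1) * frame_coeff k (\<theta> t) j m)) = 0"
      by (rule sum.neutral) (auto simp: frame_coeff_def)
    moreover have "(\<Sum>j=1..m. a j * (sin_prod (\<theta> t) 0 (j - 1) * frame_coeff k (\<theta> t) j m)) =
      (\<Sum>j=1..m. a j * (sin_prod (\<theta> t) 0 (j - 1) * cos (\<theta> t j) * sin_prod (\<theta> t) j m)) * cos (\<theta> t (Suc m))"
      using False by (auto simp: sum_distrib_right frame_coeff_def tail_hyper_def intro!: sum.cong)
    ultimately show ?thesis
      by (subst set, subst sum.union_disjoint; (subst sum.union_disjoint)?)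
        (auto simp: frame_coeff_def)
  qed
  ultimately show ?thesis
    using False by (simp add: tail_hyper_def)
qed

text \<open>The partial derivative of \<open>hyper\<close> in angle \<open>j\<close>: a unit vector
  scaled by the product of the preceding sines. The argument \<open>Suc k - r\<close> appears
  because the product of sines shortens as the coordinate number grows.\<close>

definition hyper_deriv :: "nat \<Rightarrow> (nat \<Rightarrow> real) \<Rightarrow> nat \<Rightarrow> real ^ 'm::enum" where
  "hyper_deriv k \<theta> j = of_cos (\<lambda>r. sin_prod \<theta> 0 (j - 1) * frame_coeff k \<theta> j (Suc k - r))"

lemma hyper_eq_of_cos:
  assumes "CARD('m::enum) = k + 1"
  shows "(hyper k \<theta> :: real ^ 'm::enum) = of_cos (\<lambda>r. tail_hyper k \<theta> 0 (Suc k - r))"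
  unfolding hyper_def
proof (rule of_cos_cong)
  fix r assume r: "1 \<le> r" "r \<le> CARD('m)"
  have "{1..Suc k - r} = {0<..Suc k - r}" by auto
  moreover have "Suc k - r = k \<longleftrightarrow> r = 1" "k + 2 - r = Suc k - r + 1" "k + 1 - r = Suc k - r" using r assms by auto
  ultimately show "(\<Prod>j=1..k+1-r. sin (\<theta> j)) * (if r = 1 then 1 else cos (\<theta> (k + 2 - r))) =
      tail_hyper k \<theta> 0 (Suc k - r)"
    by (simp add: tail_hyper_def sin_prod_def)
qed

lemma inner_of_cos_rev:
  assumes "CARD('m::enum) = k + 1"
  shows "(of_cos (\<lambda>r. f (Suc k - r)) :: real ^ 'm::enum) \<bullet> of_cos (\<lambda>r. g (Suc k - r)) = (\<Sum>m\<le>k. f m * g m)"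
proof -
  have "(of_cos (\<lambda>r. f (Suc k - r)) :: real ^ 'm::enum) \<bullet> of_cos (\<lambda>r. g (Suc k - r)) =
      (\<Sum>r=1..k+1. f (Suc k - r) * g (Suc k - r))"
    unfolding inner_eq_sum_co assms using assms by (intro sum.cong) (simp_all add: co_of_cos)
  also have "\<dots> = (\<Sum>m\<le>k. f m * g m)"
    by (rule sum.reindex_bij_witness[of _ "\<lambda>m. Suc k - m" "\<lambda>r. Suc k - r"]) auto
  finally show ?thesis .
qed

lemma norm_hyper:
  assumes "CARD('m::enum) = k + 1"
  shows "norm (hyper k \<theta> :: real ^ 'm::enum) = 1"
proof -
  have "(hyper k \<theta> :: real ^ 'm::enum) \<bullet> hyper k \<theta> = 1"
    using sum_tail_hyper_sq[of 0 k \<theta>]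
    by (simp add: hyper_eq_of_cos[OF assms] inner_of_cos_rev[OF assms] power2_eq_square atMost_atLeast0)
  then show ?thesis by (simp add: norm_eq_1)
qed

lemma inner_hyper_hyper_deriv:
  assumes "CARD('m::enum) = k + 1" "1 \<le> j" "j \<le> k"
  shows "(hyper k \<theta> :: real ^ 'm::enum) \<bullet> hyper_deriv k \<theta> j = 0"
proof -
  have "(\<Sum>m\<le>k. tail_hyper k \<theta> 0 m * (sin_prod \<theta> 0 (j - 1) * frame_coeff k \<theta> j m)) = 0"
    using tail_hyper_frame_orthogonal[of 0 j k "sin_prod \<theta> 0 (j - 1)" \<theta>] assms
    by (simp add: ac_simps)
  then show ?thesis
    using inner_of_cos_rev[OF assms(1), of "tail_hyper k \<theta> 0" "\<lambda>m. sin_prod \<theta> 0 (j - 1) * frame_coeff k \<theta> j m"]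
    by (simp add: hyper_eq_of_cos[OF assms(1)] hyper_deriv_def)
qed

text \<open>Orthonormality of \<open>frame_coeff\<close> leaves only the scaling factors. The frame
  can therefore degenerate only where one of the sines before the last angle vanishes.\<close>

lemma inner_hyper_deriv:
  assumes "CARD('m::enum) = k + 1" "1 \<le> i" "i \<le> k" "1 \<le> j" "j \<le> k"
  shows "(hyper_deriv k \<theta> i :: real ^ 'm::enum) \<bullet> hyper_deriv k \<theta> j =
    (if i = j then (sin_prod \<theta> 0 (j - 1))\<^sup>2 else 0)"
proof -
  have *: "(\<Sum>m\<le>k. frame_coeff k \<theta> i m * frame_coeff k \<theta> j m) = (if i = j then 1 else 0)"
    using frame_coeff_orthogonal[of i j k \<theta>] frame_coeff_orthogonal[of j i k \<theta>]
      sum_frame_coeff_sq[of j k \<theta>] assms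
    by (auto simp: mult.commute[of "frame_coeff k \<theta> i _"] neq_iff)
  have "(hyper_deriv k \<theta> i :: real ^ 'm::enum) \<bullet> hyper_deriv k \<theta> j =
      sin_prod \<theta> 0 (i - 1) * sin_prod \<theta> 0 (j - 1) * (\<Sum>m\<le>k. frame_coeff k \<theta> i m * frame_coeff k \<theta> j m)"
    using inner_of_cos_rev[OF assms(1), of "\<lambda>m. sin_prod \<theta> 0 (i - 1) * frame_coeff k \<theta> i m"
        "\<lambda>m. sin_prod \<theta> 0 (j - 1) * frame_coeff k \<theta> j m"]
    by (simp add: hyper_deriv_def sum_distrib_left ac_simps)
  then show ?thesis
    by (simp add: * power2_eq_square)
qed

lemma has_vector_derivative_hyper:
  assumes "CARD('m::enum) = k + 1"
    and "\<And>j. 1 \<le> j \<Longrightarrow> j \<le> k \<Longrightarrow> ((\<lambda>s. \<theta> s j) has_real_derivative a j) (at t within I)"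
  shows "((\<lambda>s. hyper k (\<theta> s) :: real ^ 'm::enum) has_vector_derivative
    (\<Sum>j=1..k. a j *\<^sub>R hyper_deriv k (\<theta> t) j)) (at t within I)"
proof -
  have "((\<lambda>s. of_cos (\<lambda>r. tail_hyper k (\<theta> s) 0 (Suc k - r)) :: real ^ 'm::enum) has_vector_derivative
      of_cos (\<lambda>r. \<Sum>j=1..k. a j * (sin_prod (\<theta> t) 0 (j - 1) * frame_coeff k (\<theta> t) j (Suc k - r)))) (at t within I)"
    using assms by (intro has_vector_derivative_of_cos has_real_derivative_tail_hyper) auto
  moreover have "of_cos (\<lambda>r. \<Sum>j=1..k. a j * (sin_prod (\<theta> t) 0 (j - 1) * frame_coeff k (\<theta> t) j (Suc k - r))) =
      (\<Sum>j=1..k. a j *\<^sub>R (hyper_deriv k (\<theta> t) j :: real ^ 'm::enum))"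
    by (simp add: vec_eq_iff of_cos_def hyper_deriv_def sum_component)
  ultimately show ?thesis
    by (simp add: hyper_eq_of_cos[OF assms(1)])
qed

section \<open>Differentiability of the angles along a differentiable curve on the sphere\<close>

text \<open>The open range keeps the cosine strictly between -1 and 1, where \<open>arccos\<close>
  is differentiable and inverts it.\<close>

lemma differentiable_angle_arccos:
  fixes f :: "real \<Rightarrow> real"
  assumes "(\<lambda>s. cos (f s)) differentiable (at t within I)" "\<And>s. s \<in> I \<Longrightarrow> 0 < f s \<and> f s < pi" "t \<in> I"
  shows "f differentiable (at t within I)"
proof -
  obtain c where c: "((\<lambda>s. cos (f s)) has_real_derivative c) (at t within I)"
    using assms(1) by (auto simp: real_differentiable_def)
  have "sin (f t) > 0" using assms(2,3) by (simp add: sin_gt_zero)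
  then have "\<bar>cos (f t)\<bar> < 1"
    using sin_cos_squared_add[of "f t"] by (metis abs_square_less_1 add_less_same_cancel2 add.commute less_add_same_cancel2 zero_less_power)
  then have "-1 < cos (f t)" "cos (f t) < 1" by auto
  then have "((\<lambda>s. arccos (cos (f s))) has_real_derivative inverse (- sqrt (1 - (cos (f t))\<^sup>2)) * c) (at t within I)"
    by (intro DERIV_chain2[OF DERIV_arccos c])
  moreover have "arccos (cos (f s)) = f s" if "s \<in> I" for s
    using assms(2)[OF that] by (intro arccos_cos) auto
  ultimately have "(f has_real_derivative inverse (- sqrt (1 - (cos (f t))\<^sup>2)) * c) (at t within I)"
    using assms(3) by (metis (no_types, lifting) has_field_derivative_transform_within zero_less_one)
  then show ?thesis by (auto simp: real_differentiable_def)
qed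

text \<open>Near \<open>t\<close> the continuous function \<open>f s - f t\<close> is the arcsine of
  \<open>sin (f s) cos (f t) - cos (f s) sin (f t)\<close>.\<close>

lemma differentiable_angle_arcsin:
  fixes f :: "real \<Rightarrow> real"
  assumes "(\<lambda>s. cos (f s)) differentiable (at t within I)" "(\<lambda>s. sin (f s)) differentiable (at t within I)"
    and "continuous_on I f" "t \<in> I"
  shows "f differentiable (at t within I)"
proof -
  obtain c d where c: "((\<lambda>s. cos (f s)) has_real_derivative c) (at t within I)"
    and d: "((\<lambda>s. sin (f s)) has_real_derivative d) (at t within I)"
    using assms(1,2) by (auto simp: real_differentiable_def)
  define e where "e = d * cos (f t) - c * sin (f t)"
  have "((\<lambda>s. sin (f s) * cos (f t) - cos (f s) * sin (f t)) has_real_derivative e) (at t within I)"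
    unfolding e_def by (rule derivative_eq_intros c d refl | simp)+
  then have *: "((\<lambda>s. sin (f s - f t)) has_real_derivative e) (at t within I)"
    by (simp add: sin_diff)
  have "((\<lambda>s. f t + arcsin (sin (f s - f t))) has_real_derivative
      0 + inverse (sqrt (1 - (sin (f t - f t))\<^sup>2)) * e) (at t within I)"
    by (intro DERIV_add DERIV_const DERIV_chain2[OF DERIV_arcsin *]) auto
  moreover obtain r where "r > 0" and r: "\<And>s. s \<in> I \<Longrightarrow> dist s t < r \<Longrightarrow> dist (f s) (f t) < pi / 2"
    using assms(3,4) pi_half_gt_zero unfolding continuous_on_iff by blast
  moreover have "f t + arcsin (sin (f s - f t)) = f s" if "s \<in> I" "dist s t < r" for s
    using r[OF that] unfolding dist_real_def by (subst arcsin_sin) linarith+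
  ultimately have "(f has_real_derivative 0 + inverse (sqrt (1 - (sin (f t - f t))\<^sup>2)) * e) (at t within I)"
    using assms(4) by (auto intro: has_field_derivative_transform_within)
  then show ?thesis by (auto simp: real_differentiable_def)
qed

text \<open>Angles below \<open>k\<close> follow from their cosines. The last angle ranges over a
  full circle, where the cosine alone does not determine it; its sine, its cosine and its continuity
  are used together.\<close>

lemma differentiable_angles:
  fixes \<theta> :: "real \<Rightarrow> nat \<Rightarrow> real"
  assumes card: "CARD('m::enum) = k + 1" and "1 \<le> k" and "t \<in> I"
    and diff: "(\<lambda>s. hyper k (\<theta> s) :: real ^ 'm::enum) differentiable (at t within I)"
    and dom: "\<And>s j. s \<in> I \<Longrightarrow> 1 \<le> j \<Longrightarrow> j < k \<Longrightarrow> 0 < \<theta> s j \<and> \<theta> s j < pi"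
    and cont: "continuous_on I (\<lambda>s. \<theta> s k)"
    and j: "1 \<le> j" "j \<le> k"
  shows "(\<lambda>s. \<theta> s j) differentiable (at t within I)"
proof -
  have comp: "(\<lambda>s. tail_hyper k (\<theta> s) 0 m) differentiable (at t within I)" if "m \<le> k" for m
  proof -
    have "co (hyper k (\<theta> s) :: real ^ 'm::enum) (Suc k - m) = tail_hyper k (\<theta> s) 0 m" for s
    proof -
      have "Suc k - (Suc k - m) = m" "1 \<le> Suc k - m" using that by auto
      then show ?thesis using card by (simp add: hyper_eq_of_cos co_of_cos)
    qed
    moreover have "(\<lambda>s. co (hyper k (\<theta> s) :: real ^ 'm::enum) (Suc k - m)) differentiable (at t within I)"
      using diff bounded_linear.has_derivative[OF bounded_linear_co]
      unfolding differentiable_def by blast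
    ultimately show ?thesis by simp
  qed
  have nz: "sin_prod (\<theta> s) 0 m \<noteq> 0" if "s \<in> I" "m < k" for s m
    using that dom by (intro sin_prod_nonzero) (metis less_irrefl order.strict_trans1 sin_gt_zero)
  \<comment> \<open>Dividing a coordinate by the nonvanishing product of earlier sines isolates its
    last factor.\<close>
  have quot: "g differentiable (at t within I)"
    if "(\<lambda>s. sin_prod (\<theta> s) 0 m) differentiable (at t within I)" "m < k"
      "(\<lambda>s. sin_prod (\<theta> s) 0 m * g s) differentiable (at t within I)" for m and g :: "real \<Rightarrow> real"
  proof -
    have "(\<lambda>s. (sin_prod (\<theta> s) 0 m * g s) / sin_prod (\<theta> s) 0 m) differentiable (at t within I)"
      using that nz \<open>t \<in> I\<close> by (intro differentiable_divide) auto
    then show ?thesis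
      using nz[OF _ that(2)] \<open>t \<in> I\<close>
      by (elim differentiable_transform_within[where d = 1]) auto
  qed
  have cosd: "(\<lambda>s. cos (\<theta> s (Suc m))) differentiable (at t within I)"
    if "(\<lambda>s. sin_prod (\<theta> s) 0 m) differentiable (at t within I)" "m < k" for m
  proof (rule quot[OF that])
    show "(\<lambda>s. sin_prod (\<theta> s) 0 m * cos (\<theta> s (Suc m))) differentiable (at t within I)"
      using comp[of m] that by (simp add: tail_hyper_def)
  qed
  \<comment> \<open>Each round goes from the product of sines to the cosine of the next angle, then
    to that angle, then to its sine, which extends the product. The bound \<open>m < k\<close> stays
    within the angles of open range.\<close>
  have prodd: "(\<lambda>s. sin_prod (\<theta> s) 0 m) differentiable (at t within I)" if "m < k" for m
    using that
  proof (induction m)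
    case (Suc m)
    then have IH: "(\<lambda>s. sin_prod (\<theta> s) 0 m) differentiable (at t within I)" by simp
    have "(\<lambda>s. \<theta> s (Suc m)) differentiable (at t within I)"
    proof (rule differentiable_angle_arccos)
      show "(\<lambda>s. cos (\<theta> s (Suc m))) differentiable (at t within I)"
        using Suc.prems by (intro cosd[OF IH]) simp
      show "0 < \<theta> s (Suc m) \<and> \<theta> s (Suc m) < pi" if "s \<in> I" for s
        using that Suc.prems dom[of s "Suc m"] by simp
    qed (fact \<open>t \<in> I\<close>)
    then obtain d where "((\<lambda>s. \<theta> s (Suc m)) has_real_derivative d) (at t within I)"
      by (auto simp: real_differentiable_def)
    then have "((\<lambda>s. sin (\<theta> s (Suc m))) has_real_derivative cos (\<theta> t (Suc m)) * d) (at t within I)"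
      by (rule DERIV_chain2[OF DERIV_sin])
    then have "(\<lambda>s. sin (\<theta> s (Suc m))) differentiable (at t within I)"
      by (auto simp: real_differentiable_def)
    with IH show ?case
      unfolding sin_prod_Suc[OF le0] by (rule differentiable_mult)
  qed simp
  have cosj: "(\<lambda>s. cos (\<theta> s j)) differentiable (at t within I)"
  proof -
    have "j - 1 < k" using j by simp
    from cosd[OF prodd[OF this] this] show ?thesis using j by simp
  qed
  show ?thesis
  proof (cases "j = k")
    case True
    \<comment> \<open>Coordinate \<open>m = k\<close> is the product of all sines, hence yields the
      sine of the last angle after division.\<close>
    have "(\<lambda>s. sin_prod (\<theta> s) 0 (k - 1) * sin (\<theta> s k)) differentiable (at t within I)"
      using comp[of k] \<open>1 \<le> k\<close> sin_prod_Suc[of 0 "k - 1"] by (simp add: tail_hyper_def)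
    then have "(\<lambda>s. sin (\<theta> s k)) differentiable (at t within I)"
      using \<open>1 \<le> k\<close> by (elim quot[OF prodd, rotated 2]) simp_all
    from differentiable_angle_arcsin[OF cosj[unfolded True] this cont \<open>t \<in> I\<close>] show ?thesis
      unfolding True .
  next
    case False
    then show ?thesis
      using j by (auto intro: differentiable_angle_arccos[OF cosj dom \<open>t \<in> I\<close>])
  qed
qed

section \<open>Rotated hyperspherical charts\<close>

definition chart_deriv :: "((nat \<Rightarrow> real) \<Rightarrow> real ^ 'm::enum) \<Rightarrow> (nat \<Rightarrow> real) \<Rightarrow> nat \<Rightarrow> real ^ 'm::enum" where
  "chart_deriv \<phi> \<theta> j = vector_derivative (\<lambda>s. \<phi> (\<theta>(j := s))) (at (\<theta> j))"

text \<open>The part of \<open>angle_dom\<close> that keeps the frame nondegenerate: the lengths of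
  the frame vectors involve the sines of angles 1 to \<open>k - 1\<close> only.\<close>

definition regular_angles :: "nat \<Rightarrow> (nat \<Rightarrow> real) \<Rightarrow> bool" where
  "regular_angles k \<theta> \<longleftrightarrow> (\<forall>j\<in>{1..<k}. 0 < \<theta> j \<and> \<theta> j < pi)"

locale sphere_chart =
  fixes k :: nat and \<phi> :: "(nat \<Rightarrow> real) \<Rightarrow> real ^ 'm::enum"
  assumes card_coords: "CARD('m) = k + 1"
    and k_pos: "1 \<le> k"
    and rotated_hyper: "\<exists>R :: real ^ 'm::enum \<Rightarrow> real ^ 'm::enum. orthogonal_transformation R \<and> \<phi> = (\<lambda>\<theta>. R (hyper k \<theta>))"
begin

text \<open>A fixed witness of \<open>rotated_hyper\<close>. As it is linear and preserves inner
  products, all facts about \<open>hyper\<close> carry over to the chart.\<close>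

definition rotation :: "real ^ 'm::enum \<Rightarrow> real ^ 'm::enum" where
  "rotation = (SOME R. orthogonal_transformation R \<and> \<phi> = (\<lambda>\<theta>. R (hyper k \<theta>)))"

lemma rotation: "orthogonal_transformation rotation" "\<phi> \<theta> = rotation (hyper k \<theta>)"
proof -
  have "orthogonal_transformation rotation \<and> \<phi> = (\<lambda>\<theta>. rotation (hyper k \<theta>))"
    unfolding rotation_def by (rule someI_ex[OF rotated_hyper])
  then show "orthogonal_transformation rotation" "\<phi> \<theta> = rotation (hyper k \<theta>)"
    by (auto dest: fun_cong)
qed

lemma linear_rotation: "linear rotation"
  by (rule orthogonal_transformation_linear[OF rotation(1)])

lemma inner_rotation: "rotation x \<bullet> rotation y = x \<bullet> y"
  using rotation(1) by (simp add: orthogonal_transformation_def)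

lemma norm_chart: "norm (\<phi> \<theta>) = 1"
  by (simp add: rotation(2) orthogonal_transformation_norm[OF rotation(1)] norm_hyper[OF card_coords])

lemma inner_chart_self: "\<phi> \<theta> \<bullet> \<phi> \<theta> = 1"
  using norm_chart by (simp add: norm_eq_1)

lemma chart_curve_rotation:
  assumes "\<And>j. 1 \<le> j \<Longrightarrow> j \<le> k \<Longrightarrow> ((\<lambda>s. \<theta> s j) has_real_derivative a j) (at t within I)"
  shows "((\<lambda>s. \<phi> (\<theta> s)) has_vector_derivative
    (\<Sum>j=1..k. a j *\<^sub>R rotation (hyper_deriv k (\<theta> t) j))) (at t within I)"
  using bounded_linear.has_vector_derivative[OF linear_conv_bounded_linear[THEN iffD1, OF linear_rotation]
      has_vector_derivative_hyper[OF card_coords assms]]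
  by (simp add: rotation(2) linear_sum[OF linear_rotation] linear_scale[OF linear_rotation])

lemma chart_deriv_eq:
  assumes "1 \<le> j" "j \<le> k"
  shows "((\<lambda>s. \<phi> (\<theta>(j := s))) has_vector_derivative rotation (hyper_deriv k \<theta> j)) (at (\<theta> j))"
    and "chart_deriv \<phi> \<theta> j = rotation (hyper_deriv k \<theta> j)"
proof -
  \<comment> \<open>Along a coordinate line only angle \<open>j\<close> moves, at unit speed, so the
    sum in \<open>chart_curve_rotation\<close> collapses to one term.\<close>
  have "((\<lambda>s. (\<theta>(j := s)) i) has_real_derivative (if i = j then 1 else 0)) (at (\<theta> j))" for i
    by (cases "i = j") auto
  from chart_curve_rotation[of "\<lambda>s. \<theta>(j := s)", OF this]
  show *: "((\<lambda>s. \<phi> (\<theta>(j := s))) has_vector_derivative rotation (hyper_deriv k \<theta> j)) (at (\<theta> j))"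
    using assms by (simp add: if_distrib[of "\<lambda>c. c *\<^sub>R _"] sum.delta cong: if_cong)
  then show "chart_deriv \<phi> \<theta> j = rotation (hyper_deriv k \<theta> j)"
    unfolding chart_deriv_def by (rule vector_derivative_at)
qed

lemma has_vector_derivative_chart_deriv:
  assumes "1 \<le> j" "j \<le> k"
  shows "((\<lambda>s. \<phi> (\<theta>(j := s))) has_vector_derivative chart_deriv \<phi> \<theta> j) (at (\<theta> j))"
  using chart_deriv_eq[OF assms] by simp

lemma has_vector_derivative_chart_curve:
  assumes "\<And>j. 1 \<le> j \<Longrightarrow> j \<le> k \<Longrightarrow> ((\<lambda>s. \<theta> s j) has_real_derivative a j) (at t within I)"
  shows "((\<lambda>s. \<phi> (\<theta> s)) has_vector_derivative (\<Sum>j=1..k. a j *\<^sub>R chart_deriv \<phi> (\<theta> t) j)) (at t within I)"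
  using chart_curve_rotation[OF assms] by (simp add: chart_deriv_eq)

lemma d_phi_eq:
  assumes "1 \<le> j" "j \<le> k"
  shows "d_phi \<phi> \<theta> j r = co (chart_deriv \<phi> \<theta> j) r"
proof -
  have "((\<lambda>s. co (\<phi> (\<theta>(j := s))) r) has_vector_derivative co (chart_deriv \<phi> \<theta> j) r) (at (\<theta> j))"
    by (rule bounded_linear.has_vector_derivative[OF bounded_linear_co has_vector_derivative_chart_deriv[OF assms]])
  then show ?thesis
    unfolding d_phi_def by (intro DERIV_imp_deriv) (simp add: has_real_derivative_iff_has_vector_derivative)
qed

lemma inner_chart_chart_deriv:
  "1 \<le> j \<Longrightarrow> j \<le> k \<Longrightarrow> \<phi> \<theta> \<bullet> chart_deriv \<phi> \<theta> j = 0"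
  by (simp add: chart_deriv_eq rotation(2) inner_rotation inner_hyper_hyper_deriv[OF card_coords])

lemma inner_chart_deriv_chart:
  "1 \<le> j \<Longrightarrow> j \<le> k \<Longrightarrow> chart_deriv \<phi> \<theta> j \<bullet> \<phi> \<theta> = 0"
  using inner_chart_chart_deriv by (simp add: inner_commute)

lemma inner_chart_deriv:
  assumes "1 \<le> i" "i \<le> k" "1 \<le> j" "j \<le> k"
  shows "chart_deriv \<phi> \<theta> i \<bullet> chart_deriv \<phi> \<theta> j = (if i = j then (sin_prod \<theta> 0 (j - 1))\<^sup>2 else 0)"
  using assms by (simp add: chart_deriv_eq inner_rotation inner_hyper_deriv[OF card_coords])

lemma norm_chart_deriv_1: "norm (chart_deriv \<phi> \<theta> 1) = 1"
  using inner_chart_deriv[of 1 1 \<theta>] k_pos by (simp add: norm_eq_1)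

lemma chart_deriv_nonzero:
  assumes "regular_angles k \<theta>" "1 \<le> j" "j \<le> k"
  shows "chart_deriv \<phi> \<theta> j \<noteq> 0"
proof -
  have "sin (\<theta> l) \<noteq> 0" if "1 \<le> l" "l \<le> j - 1" for l
    using assms that sin_gt_zero[of "\<theta> l"] by (force simp: regular_angles_def)
  then have "sin_prod \<theta> 0 (j - 1) \<noteq> 0"
    by (intro sin_prod_nonzero)
  then have "chart_deriv \<phi> \<theta> j \<bullet> chart_deriv \<phi> \<theta> j \<noteq> 0"
    using assms by (simp add: inner_chart_deriv)
  then show ?thesis by auto
qed

lemma inj_on_chart_deriv: "regular_angles k \<theta> \<Longrightarrow> inj_on (chart_deriv \<phi> \<theta>) {1..k}"
  using inner_chart_deriv[of _ _ \<theta>] chart_deriv_nonzero[of \<theta>]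
  by (intro inj_onI) (metis atLeastAtMost_iff inner_eq_zero_iff)

lemma pairwise_orthogonal_frame: "pairwise orthogonal (insert (\<phi> \<theta>) (chart_deriv \<phi> \<theta> ` {1..k}))"
  by (auto simp: pairwise_def orthogonal_def inner_chart_chart_deriv inner_chart_deriv
      inner_chart_deriv_chart)

lemma frame_nonzero: "regular_angles k \<theta> \<Longrightarrow> 0 \<notin> insert (\<phi> \<theta>) (chart_deriv \<phi> \<theta> ` {1..k})"
  using chart_deriv_nonzero[of \<theta>] norm_chart[of \<theta>] by (metis (no_types, lifting) atLeastAtMost_iff image_iff insert_iff norm_zero zero_neq_one)

text \<open>The normal and the \<open>k\<close> partial derivatives are nonzero and pairwise
  orthogonal, hence independent, and their number is the dimension.\<close>

lemma span_frame:
  assumes "regular_angles k \<theta>"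
  shows "span (insert (\<phi> \<theta>) (chart_deriv \<phi> \<theta> ` {1..k})) = UNIV"
proof -
  let ?B = "insert (\<phi> \<theta>) (chart_deriv \<phi> \<theta> ` {1..k})"
  have ind: "independent ?B"
    by (rule pairwise_orthogonal_independent[OF pairwise_orthogonal_frame frame_nonzero[OF assms]])
  have "\<phi> \<theta> \<notin> chart_deriv \<phi> \<theta> ` {1..k}"
    using inner_chart_chart_deriv[of _ \<theta>] inner_chart_self[of \<theta>] by force
  then have "card ?B = k + 1"
    using card_image[OF inj_on_chart_deriv[OF assms]] by simp
  then have "card ?B = DIM(real ^ 'm::enum)"
    by (simp add: card_coords)
  then show ?thesis
    using ind card_eq_dim[of ?B UNIV] by (auto simp: dim_UNIV)
qed

text \<open>The difference of the two sides is orthogonal to each frame vector; as these span the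
  space, it is orthogonal to itself. The squared norms occur because the partial derivatives are not
  normalised.\<close>

lemma chart_frame_expansion:
  assumes "regular_angles k \<theta>"
  shows "u = (u \<bullet> \<phi> \<theta>) *\<^sub>R \<phi> \<theta> +
    (\<Sum>j=1..k. (u \<bullet> chart_deriv \<phi> \<theta> j / (norm (chart_deriv \<phi> \<theta> j))\<^sup>2) *\<^sub>R chart_deriv \<phi> \<theta> j)"
    (is "u = ?e")
proof -
  have "orthogonal (u - ?e) b" if "b \<in> insert (\<phi> \<theta>) (chart_deriv \<phi> \<theta> ` {1..k})" for b
    using that
  proof (elim insertE imageE)
    assume "b = \<phi> \<theta>"
    then show ?thesis
      by (simp add: orthogonal_def inner_diff_left inner_add_left inner_sum_left inner_chart_self
          inner_chart_deriv_chart)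
  next
    fix i assume b: "b = chart_deriv \<phi> \<theta> i" and i: "i \<in> {1..k}"
    have nz: "chart_deriv \<phi> \<theta> i \<noteq> 0"
      using chart_deriv_nonzero[OF assms, of i] i by simp
    have "(\<Sum>j=1..k. (u \<bullet> chart_deriv \<phi> \<theta> j / (norm (chart_deriv \<phi> \<theta> j))\<^sup>2) * (chart_deriv \<phi> \<theta> j \<bullet> chart_deriv \<phi> \<theta> i)) =
        (\<Sum>j=1..k. if j = i then u \<bullet> chart_deriv \<phi> \<theta> i else 0)"
    proof (rule sum.cong)
      fix j assume "j \<in> {1..k}"
      then show "(u \<bullet> chart_deriv \<phi> \<theta> j / (norm (chart_deriv \<phi> \<theta> j))\<^sup>2) * (chart_deriv \<phi> \<theta> j \<bullet> chart_deriv \<phi> \<theta> i) =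
          (if j = i then u \<bullet> chart_deriv \<phi> \<theta> i else 0)"
        using i nz by (cases "j = i") (simp_all flip: power2_norm_eq_inner add: inner_chart_deriv[of j i \<theta>])
    qed simp
    also have "\<dots> = u \<bullet> chart_deriv \<phi> \<theta> i"
      using i by simp
    finally show ?thesis
      using i by (simp add: b orthogonal_def inner_diff_left inner_add_left inner_sum_left inner_chart_chart_deriv)
  qed
  then have "\<And>b. b \<in> insert (\<phi> \<theta>) (chart_deriv \<phi> \<theta> ` {1..k}) \<Longrightarrow> orthogonal (u - ?e) b" .
  moreover have "u - ?e \<in> span (insert (\<phi> \<theta>) (chart_deriv \<phi> \<theta> ` {1..k}))"
    by (simp only: span_frame[OF assms] UNIV_I)
  ultimately have "orthogonal (u - ?e) (u - ?e)"
    by (rule orthogonal_to_span[rotated])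
  then show ?thesis
    by (simp add: orthogonal_self)
qed

lemma span_chart_deriv:
  assumes "regular_angles k \<theta>"
  shows "span (chart_deriv \<phi> \<theta> ` {1..k}) = {v. v \<bullet> \<phi> \<theta> = 0}"
proof (intro equalityI subsetI)
  fix v assume "v \<in> span (chart_deriv \<phi> \<theta> ` {1..k})"
  then have "orthogonal (\<phi> \<theta>) v"
    by (rule orthogonal_to_span) (auto simp: orthogonal_def inner_chart_chart_deriv)
  then show "v \<in> {v. v \<bullet> \<phi> \<theta> = 0}"
    by (simp add: orthogonal_def inner_commute)
next
  fix v assume "v \<in> {v. v \<bullet> \<phi> \<theta> = 0}"
  then have "v = (\<Sum>j=1..k. (v \<bullet> chart_deriv \<phi> \<theta> j / (norm (chart_deriv \<phi> \<theta> j))\<^sup>2) *\<^sub>R chart_deriv \<phi> \<theta> j)"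
    using chart_frame_expansion[OF assms, of v] by simp
  also have "\<dots> \<in> span (chart_deriv \<phi> \<theta> ` {1..k})"
    by (intro span_sum span_scale span_base) auto
  finally show "v \<in> span (chart_deriv \<phi> \<theta> ` {1..k})" .
qed

lemma independent_chart_deriv:
  assumes "regular_angles k \<theta>"
  shows "independent (chart_deriv \<phi> \<theta> ` {1..k})"
proof (rule pairwise_orthogonal_independent)
  show "pairwise orthogonal (chart_deriv \<phi> \<theta> ` {1..k})"
    by (rule pairwise_mono[OF pairwise_orthogonal_frame]) auto
qed (use frame_nonzero[OF assms] in auto)

text \<open>Pairing a combination with frame vector \<open>i\<close> isolates coefficient
  \<open>i\<close>, multiplied by a nonzero squared length.\<close>

lemma chart_deriv_coeffs_unique:
  fixes a b :: "nat \<Rightarrow> real"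
  assumes "regular_angles k \<theta>"
    and "(\<Sum>j=1..k. a j *\<^sub>R chart_deriv \<phi> \<theta> j) = (\<Sum>j=1..k. b j *\<^sub>R chart_deriv \<phi> \<theta> j)" and "i \<in> {1..k}"
  shows "a i = b i"
proof -
  have eq: "(\<Sum>j=1..k. c j *\<^sub>R chart_deriv \<phi> \<theta> j) \<bullet> chart_deriv \<phi> \<theta> i =
      c i * (chart_deriv \<phi> \<theta> i \<bullet> chart_deriv \<phi> \<theta> i)" for c
  proof -
    have "(\<Sum>j=1..k. c j * (chart_deriv \<phi> \<theta> j \<bullet> chart_deriv \<phi> \<theta> i)) =
        (\<Sum>j=1..k. if j = i then c i * (chart_deriv \<phi> \<theta> i \<bullet> chart_deriv \<phi> \<theta> i) else 0)"
      using assms(3) by (intro sum.cong) (auto simp: inner_chart_deriv)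
    then show ?thesis
      using assms(3) by (simp add: inner_sum_left)
  qed
  have nz: "chart_deriv \<phi> \<theta> i \<noteq> 0"
    using chart_deriv_nonzero[OF assms(1), of i] assms(3) by simp
  have "a i * (chart_deriv \<phi> \<theta> i \<bullet> chart_deriv \<phi> \<theta> i) = b i * (chart_deriv \<phi> \<theta> i \<bullet> chart_deriv \<phi> \<theta> i)"
    using eq[of a] eq[of b] unfolding assms(2) by (rule trans[OF sym])
  then show ?thesis
    using nz by simp
qed

text \<open>Applying the inverse rotation reduces the claim to the standard coordinates.\<close>

lemma differentiable_chart_angles:
  fixes \<theta> :: "real \<Rightarrow> nat \<Rightarrow> real"
  assumes "t \<in> I" "(\<lambda>s. \<phi> (\<theta> s)) differentiable (at t within I)"
    and "\<And>s. s \<in> I \<Longrightarrow> regular_angles k (\<theta> s)" and "continuous_on I (\<lambda>s. \<theta> s k)" and "1 \<le> j" "j \<le> k"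
  shows "(\<lambda>s. \<theta> s j) differentiable (at t within I)"
proof -
  obtain g where g: "orthogonal_transformation g" and inv: "\<And>x. g (rotation x) = x"
    using orthogonal_transformation_inv[OF rotation(1)] orthogonal_transformation_inj[OF rotation(1)]
    by (metis inv_f_f)
  have "bounded_linear g"
    using orthogonal_transformation_linear[OF g] by (simp add: linear_conv_bounded_linear)
  from bounded_linear.has_derivative[OF this] assms(2)
  have "(\<lambda>s. g (\<phi> (\<theta> s))) differentiable (at t within I)"
    unfolding differentiable_def by blast
  then have "(\<lambda>s. hyper k (\<theta> s) :: real ^ 'm::enum) differentiable (at t within I)"
    by (simp add: rotation(2) inv)
  then show ?thesis
    using assms by (auto simp: regular_angles_def intro: differentiable_angles[OF card_coords k_pos assms(1)])
qed

end

section \<open>Tangent vectors of the sphere and of the configuration space\<close>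

definition link :: "'b::real_vector ^ 'p::enum \<Rightarrow> nat \<Rightarrow> 'b" where
  "link q i = pt q (Suc i) - pt q i"

lemma pt_eq_sum_link: "pt q i = pt q 0 + (\<Sum>j<i. link q j)"
  by (simp add: link_def sum_lessThan_telescope)

text \<open>A connected set with more than one point has no isolated point. This makes derivatives
  within the interval unique, also at its endpoints.\<close>

lemma at_within_interval_nontrivial:
  fixes I :: "real set"
  assumes "is_interval I" "interior I \<noteq> {}" "t \<in> I"
  shows "at t within I \<noteq> bot"
proof -
  have "connected I" using assms(1) by (simp add: is_interval_connected)
  moreover have "I \<noteq> {t}" using assms(2) by (metis interior_singleton)
  ultimately have "t islimpt I"
    using assms(3) by (intro connected_imp_perfect) auto
  then show ?thesis by (simp add: trivial_limit_within)
qed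

text \<open>Differentiate the constant \<open>f s \<bullet> f s\<close>; uniqueness of the
  derivative within \<open>I\<close> forces twice the inner product to vanish.\<close>

lemma inner_derivative_of_unit_curve:
  fixes f :: "real \<Rightarrow> 'a::real_inner"
  assumes "(f has_vector_derivative v) (at t within I)" "\<And>s. s \<in> I \<Longrightarrow> f s \<bullet> f s = 1"
    and "t \<in> I" "at t within I \<noteq> bot"
  shows "v \<bullet> f t = 0"
proof -
  have "((\<lambda>s. f s \<bullet> f s) has_vector_derivative (f t \<bullet> v + v \<bullet> f t)) (at t within I)"
    by (rule bounded_bilinear.has_vector_derivative[OF bounded_bilinear_inner assms(1,1)])
  moreover have "((\<lambda>s. f s \<bullet> f s) has_vector_derivative 0) (at t within I)"
    using assms(2,3)
    by (intro has_vector_derivative_transform[OF _ _ has_vector_derivative_const[of 1]]) auto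
  ultimately have "f t \<bullet> v + v \<bullet> f t = 0"
    using vector_derivative_unique_within[OF assms(4)] by blast
  then show ?thesis by (simp add: inner_commute)
qed

text \<open>For \<open>w = 0\<close> the junk value \<open>0 / 0 = 0\<close> makes this the constant curve \<open>z\<close>, as desired.\<close>

definition great_circle :: "'a::real_inner \<Rightarrow> 'a \<Rightarrow> real \<Rightarrow> 'a" where
  "great_circle z w s = cos (norm w * s) *\<^sub>R z + (sin (norm w * s) / norm w) *\<^sub>R w"

definition great_circle_deriv :: "'a::real_inner \<Rightarrow> 'a \<Rightarrow> real \<Rightarrow> 'a" where
  "great_circle_deriv z w s = (- (norm w * sin (norm w * s))) *\<^sub>R z + cos (norm w * s) *\<^sub>R w"

lemma has_vector_derivative_great_circle:
  "(great_circle z w has_vector_derivative great_circle_deriv z w s) (at s)"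
proof -
  have "((\<lambda>s. cos (norm w * s)) has_real_derivative - (norm w * sin (norm w * s))) (at s)"
    by (rule derivative_eq_intros refl | simp)+
  moreover have "((\<lambda>s. sin (norm w * s) / norm w) has_real_derivative (cos (norm w * s) * norm w) / norm w) (at s)"
    by (intro DERIV_cdivide DERIV_chain2[OF DERIV_sin]) (rule derivative_eq_intros refl | simp)+
  ultimately have "(great_circle z w has_vector_derivative
      (- (norm w * sin (norm w * s))) *\<^sub>R z + (cos (norm w * s) * norm w / norm w) *\<^sub>R w) (at s)"
    unfolding great_circle_def
    by (intro has_vector_derivative_add bounded_linear.has_vector_derivative[OF bounded_linear_scaleR_left])
      (simp_all add: has_real_derivative_iff_has_vector_derivative)
  then show ?thesis
    by (cases "w = 0") (simp_all add: great_circle_deriv_def)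
qed

lemma great_circle_0: "great_circle z w 0 = z" "great_circle_deriv z w 0 = w"
  by (simp_all add: great_circle_def great_circle_deriv_def)

lemma continuous_on_great_circle_deriv: "continuous_on A (great_circle_deriv z w)"
  unfolding great_circle_deriv_def by (intro continuous_intros)

lemma norm_great_circle:
  assumes "norm z = 1" "w \<bullet> z = 0"
  shows "norm (great_circle z w s) = 1"
proof -
  have z: "z \<bullet> z = 1" "z \<bullet> w = 0" using assms by (simp_all add: norm_eq_1 inner_commute)
  have "great_circle z w s \<bullet> great_circle z w s =
      (cos (norm w * s))\<^sup>2 + (sin (norm w * s) / norm w)\<^sup>2 * (w \<bullet> w)"
    by (simp add: great_circle_def inner_add_left inner_add_right z assms(2) power2_eq_square)
  also have "\<dots> = 1"
    by (cases "w = 0") (simp_all add: power_divide power2_norm_eq_inner[symmetric])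
  finally show ?thesis by (simp add: norm_eq_1)
qed

lemma tangent_spaceI:
  assumes "\<And>s. (\<gamma> has_vector_derivative \<gamma>' s) (at s)" "\<And>A. continuous_on A \<gamma>'" "\<And>s. \<gamma> s \<in> M"
    and "\<gamma> 0 = p" "\<gamma>' 0 = v"
  shows "v \<in> tangent_space M p"
proof -
  have "\<gamma> C1_differentiable_on {-1<..<1}"
    unfolding C1_differentiable_on_def using assms(1) assms(2)[of "{-1<..<1}"] by (intro exI[of _ \<gamma>']) auto
  moreover have "(\<gamma> has_vector_derivative v) (at 0)"
    using assms(1)[of 0] assms(5) by simp
  ultimately show ?thesis
    unfolding tangent_space_def using assms(3,4) by (auto intro!: exI[of _ "1::real"] exI[of _ \<gamma>])
qed

lemma tangent_spaceE:
  assumes "v \<in> tangent_space M p"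
  obtains I \<gamma> where "0 \<in> I" "at 0 within I \<noteq> bot" "\<And>s. s \<in> I \<Longrightarrow> \<gamma> s \<in> M" "\<gamma> 0 = p"
    "(\<gamma> has_vector_derivative v) (at 0 within I)"
proof -
  obtain \<epsilon> \<gamma> where \<epsilon>: "\<epsilon> > 0" and im: "\<gamma> ` {-\<epsilon><..<\<epsilon>} \<subseteq> M" and \<gamma>: "\<gamma> 0 = p"
    and d: "(\<gamma> has_vector_derivative v) (at 0)"
    using assms unfolding tangent_space_def by blast
  show thesis
  proof (rule that)
    show "at 0 within {-\<epsilon><..<\<epsilon>} \<noteq> bot"
      using \<epsilon> by (simp add: at_within_open[of 0 "{-\<epsilon><..<\<epsilon>}"])
    show "(\<gamma> has_vector_derivative v) (at 0 within {-\<epsilon><..<\<epsilon>})"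
      by (rule has_vector_derivative_at_within[OF d])
  qed (use \<epsilon> im \<gamma> in auto)
qed

text \<open>Unit curves have velocity orthogonal to the radius; conversely each orthogonal vector is
  the initial velocity of a great circle.\<close>

lemma tangent_space_sphere:
  fixes z c :: "'a::real_inner"
  assumes "norm (z - c) = 1"
  shows "tangent_space (sphere c 1) z = {v. v \<bullet> (z - c) = 0}"
proof (intro equalityI subsetI)
  fix v assume "v \<in> tangent_space (sphere c 1) z"
  then obtain I \<gamma> where I: "0 \<in> I" "at 0 within I \<noteq> bot" and im: "\<And>s. s \<in> I \<Longrightarrow> \<gamma> s \<in> sphere c 1"
    and \<gamma>: "\<gamma> 0 = z" and d: "(\<gamma> has_vector_derivative v) (at 0 within I)"
    by (rule tangent_spaceE) blast
  have "v \<bullet> (\<gamma> 0 - c) = 0"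
  proof (rule inner_derivative_of_unit_curve)
    show "((\<lambda>s. \<gamma> s - c) has_vector_derivative v) (at 0 within I)"
      using has_vector_derivative_diff[OF d has_vector_derivative_const[of c]] by simp
    show "(\<gamma> s - c) \<bullet> (\<gamma> s - c) = 1" if "s \<in> I" for s
      using im[OF that] by (simp add: dist_norm norm_minus_commute flip: norm_eq_1)
  qed (fact I)+
  then show "v \<in> {v. v \<bullet> (z - c) = 0}" by (simp add: \<gamma>)
next
  fix v assume v: "v \<in> {v. v \<bullet> (z - c) = 0}"
  show "v \<in> tangent_space (sphere c 1) z"
  proof (rule tangent_spaceI)
    show "((\<lambda>s. c + great_circle (z - c) v s) has_vector_derivative great_circle_deriv (z - c) v s) (at s)" for s
      using has_vector_derivative_add[OF has_vector_derivative_const has_vector_derivative_great_circle]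
      by simp
    show "c + great_circle (z - c) v s \<in> sphere c 1" for s
      using v norm_great_circle[OF assms] by (simp add: dist_norm)
  qed (simp_all add: great_circle_0 continuous_on_great_circle_deriv)
qed

lemma Conf_iff: "q \<in> Conf n \<longleftrightarrow> (\<forall>i\<le>n. norm (link q i) = 1)"
proof -
  have "(norm (pt q i - pt q (i + 1)))\<^sup>2 - 1 = 0 \<longleftrightarrow> norm (link q i) = 1" for i
    using norm_ge_zero[of "pt q (Suc i) - pt q i"]
    by (auto simp: link_def norm_minus_commute[of "pt q i"] power2_eq_1_iff simp del: norm_ge_zero)
  then show ?thesis unfolding Conf_def by (auto simp: atLeast0AtMost)
qed

lemma has_vector_derivative_link:
  assumes "(q has_vector_derivative v) F"
  shows "((\<lambda>s. link (q s) i) has_vector_derivative link v i) F"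
  unfolding link_def
  by (intro has_vector_derivative_diff bounded_linear.has_vector_derivative[OF bounded_linear_pt assms])

text \<open>The links move independently: given \<open>v\<close>, the first point travels in a
  straight line and each link along its own great circle, and the points are recovered as partial
  sums. The other inclusion treats each link as a unit curve.\<close>

lemma tangent_space_Conf:
  fixes q :: "('m::enum, 'p::enum) arm"
  assumes card: "CARD('p) = n + 2" and q: "q \<in> Conf n"
  shows "tangent_space (Conf n) q = {v. \<forall>i\<le>n. link v i \<bullet> link q i = 0}"
proof (intro equalityI subsetI)
  fix v assume "v \<in> tangent_space (Conf n) q"
  then obtain I \<gamma> where I: "0 \<in> I" "at 0 within I \<noteq> bot" and im: "\<And>s. s \<in> I \<Longrightarrow> \<gamma> s \<in> Conf n"
    and \<gamma>: "\<gamma> 0 = q" and d: "(\<gamma> has_vector_derivative v) (at 0 within I)"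
    by (rule tangent_spaceE) blast
  have "link v i \<bullet> link (\<gamma> 0) i = 0" if "i \<le> n" for i
  proof (rule inner_derivative_of_unit_curve[OF has_vector_derivative_link[OF d] _ I])
    show "link (\<gamma> s) i \<bullet> link (\<gamma> s) i = 1" if "s \<in> I" for s
      using im[OF that] \<open>i \<le> n\<close> by (simp add: Conf_iff flip: norm_eq_1)
  qed
  then show "v \<in> {v. \<forall>i\<le>n. link v i \<bullet> link q i = 0}" by (simp add: \<gamma>)
next
  fix v :: "('m, 'p) arm" assume v: "v \<in> {v. \<forall>i\<le>n. link v i \<bullet> link q i = 0}"
  define \<gamma> :: "real \<Rightarrow> ('m, 'p) arm" where
    "\<gamma> s = of_pts (\<lambda>i. (pt q 0 + s *\<^sub>R pt v 0) + (\<Sum>j<i. great_circle (link q j) (link v j) s))" for s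
  define \<gamma>' :: "real \<Rightarrow> ('m, 'p) arm" where
    "\<gamma>' s = of_pts (\<lambda>i. pt v 0 + (\<Sum>j<i. great_circle_deriv (link q j) (link v j) s))" for s
  have d: "(\<gamma> has_vector_derivative \<gamma>' s) (at s)" for s
    unfolding \<gamma>_def \<gamma>'_def
  proof (rule has_vector_derivative_arm_iff[THEN iffD2], intro allI impI, simp only: pt_of_pts)
    fix i
    have "((\<lambda>s. pt q 0 + s *\<^sub>R pt v 0) has_vector_derivative pt v 0) (at s)"
      by (auto intro!: derivative_eq_intros)
    then show "((\<lambda>s. (pt q 0 + s *\<^sub>R pt v 0) + (\<Sum>j<i. great_circle (link q j) (link v j) s)) has_vector_derivative
        pt v 0 + (\<Sum>j<i. great_circle_deriv (link q j) (link v j) s)) (at s)"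
      by (intro has_vector_derivative_add has_vector_derivative_sum has_vector_derivative_great_circle)
  qed
  show "v \<in> tangent_space (Conf n) q"
  proof (rule tangent_spaceI[OF d])
    show "continuous_on A \<gamma>'" for A
      unfolding \<gamma>'_def
      by (rule continuous_on_arm_iff[THEN iffD2], intro allI impI, simp only: pt_of_pts)
        (intro continuous_on_add continuous_on_sum continuous_on_great_circle_deriv continuous_on_const)
    show "\<gamma> s \<in> Conf n" for s
    proof -
      have "link (\<gamma> s) i = great_circle (link q i) (link v i) s" if "i \<le> n" for i
        using that card unfolding link_def[of "\<gamma> s"] by (simp add: \<gamma>_def pt_of_pts)
      then show ?thesis
        using q v by (simp add: Conf_iff norm_great_circle)
    qed
    show "\<gamma> 0 = q"
      by (rule arm_eqI) (simp add: \<gamma>_def pt_of_pts great_circle_0 pt_eq_sum_link[of q, symmetric])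
    show "\<gamma>' 0 = v"
      by (rule arm_eqI) (simp add: \<gamma>'_def pt_of_pts great_circle_0 pt_eq_sum_link[of v, symmetric])
  qed
qed

section \<open>The constraint distribution and the kinematic motions\<close>

lemma linear_axis: "linear (axis a :: 'b::real_normed_vector \<Rightarrow> 'b ^ 'p::finite)"
  by (rule bounded_linear.linear[OF bounded_linear_axis])

lemma ZZ_eq_axis:
  fixes q :: "('m::enum, 'p::enum) arm"
  assumes "CARD('m) = k + 1"
  shows "ZZ k i q = axis (ix i) (link q i)"
proof -
  have "ZZ k i q = axis (ix i) (\<Sum>r=1..CARD('m). co (link q i) r *\<^sub>R unit_vec r)"
    unfolding linear_sum[OF linear_axis] linear_scale[OF linear_axis] assms
    by (simp add: ZZ_def d_pt_def link_def co_diff)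
  then show ?thesis by (simp only: sum_co_unit_vec)
qed

lemma pt_generator_sum:
  fixes q :: "('m::enum, 'p::enum) arm"
  assumes "CARD('m) = k + 1" "CARD('p) = n + 2" "j \<le> n + 1"
  shows "pt ((\<Sum>i=0..n. u i *\<^sub>R ZZ k i q) + (\<Sum>r=1..k+1. w r *\<^sub>R d_pt (n + 1) r)) j =
    (if j \<le> n then u j *\<^sub>R link q j else (\<Sum>r=1..k+1. w r *\<^sub>R unit_vec r))"
proof -
  have "pt (\<Sum>i=0..n. u i *\<^sub>R ZZ k i q) j = (\<Sum>i=0..n. if i = j then u j *\<^sub>R link q j else 0)"
    using assms unfolding pt_sum by (intro sum.cong) (auto simp: pt_scaleR ZZ_eq_axis pt_axis)
  moreover have "pt (\<Sum>r=1..k+1. w r *\<^sub>R (d_pt (n + 1) r :: ('m, 'p) arm)) j =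
      (\<Sum>r=1..k+1. if j \<le> n then 0 else w r *\<^sub>R unit_vec r)"
    using assms unfolding pt_sum by (intro sum.cong) (auto simp: pt_scaleR d_pt_def pt_axis)
  ultimately show ?thesis
    using assms unfolding pt_add by simp
qed

text \<open>The last point is unconstrained in this span, so its controls are the coordinates of its
  own velocity.\<close>

lemma eq_generator_sum:
  fixes q v :: "('m::enum, 'p::enum) arm"
  assumes "CARD('m) = k + 1" "CARD('p) = n + 2" and u: "\<And>i. i \<le> n \<Longrightarrow> pt v i = u i *\<^sub>R link q i"
  shows "v = (\<Sum>i=0..n. u i *\<^sub>R ZZ k i q) + (\<Sum>r=1..k+1. co (pt v (n + 1)) r *\<^sub>R d_pt (n + 1) r)"
proof (rule arm_eqI)
  fix j assume "j < CARD('p)"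
  then have "j \<le> n + 1" using assms(1,2) by simp
  moreover have "pt v (n + 1) = (\<Sum>r=1..k+1. co (pt v (n + 1)) r *\<^sub>R unit_vec r)"
    using sum_co_unit_vec[of "pt v (n + 1)"] assms by simp
  ultimately show "pt v j = pt ((\<Sum>i=0..n. u i *\<^sub>R ZZ k i q) + (\<Sum>r=1..k+1. co (pt v (n + 1)) r *\<^sub>R d_pt (n + 1) r)) j"
    unfolding pt_generator_sum[OF assms(1,2) \<open>j \<le> n + 1\<close>] using u by (cases "j \<le> n") (auto simp: le_Suc_eq)
qed

lemma EE_iff:
  fixes q :: "('m::enum, 'p::enum) arm"
  assumes "CARD('m) = k + 1" "CARD('p) = n + 2"
  shows "v \<in> EE k n q \<longleftrightarrow> (\<exists>u. \<forall>i\<le>n. pt v i = u i *\<^sub>R link q i)"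
proof
  \<comment> \<open>Stated with \<open>span {link q i}\<close> instead of an existential over
    \<open>u\<close>, so that closure under the vector operations is inherited from
    \<open>span\<close>.\<close>
  let ?S = "{v :: ('m, 'p) arm. \<forall>i\<le>n. pt v i \<in> span {link q i}}"
  assume "v \<in> EE k n q"
  moreover have "subspace ?S"
    by (auto simp: subspace_def pt_linear intro: span_add span_scale span_zero)
  moreover have "(\<lambda>i. ZZ k i q) ` {0..n} \<union> d_pt (n + 1) ` {1..k+1} \<subseteq> ?S"
    using assms by (auto simp: ZZ_eq_axis d_pt_def pt_axis span_zero span_base)
  ultimately have "v \<in> ?S"
    unfolding EE_def using span_minimal by blast
  then show "\<exists>u. \<forall>i\<le>n. pt v i = u i *\<^sub>R link q i"
    by (auto simp: span_singleton image_iff) metis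
next
  assume "\<exists>u. \<forall>i\<le>n. pt v i = u i *\<^sub>R link q i"
  then obtain u where u: "\<And>i. i \<le> n \<Longrightarrow> pt v i = u i *\<^sub>R link q i" by blast
  from eq_generator_sum[OF assms this]
  have "v = (\<Sum>i=0..n. u i *\<^sub>R ZZ k i q) + (\<Sum>r=1..k+1. co (pt v (n + 1)) r *\<^sub>R d_pt (n + 1) r)" .
  also have "\<dots> \<in> EE k n q"
    unfolding EE_def by (intro span_add span_sum span_scale span_base) auto
  finally show "v \<in> EE k n q" .
qed

text \<open>Eliminates the controls: only membership of the velocity in the distribution
  matters.\<close>

lemma kinematic_evolution_iff:
  fixes q :: "real \<Rightarrow> ('m::enum, 'p::enum) arm"
  assumes "CARD('m) = k + 1" "CARD('p) = n + 2"
  shows "kinematic_evolution k n I q \<longleftrightarrow> (\<forall>t\<in>I. q t \<in> Conf n) \<and>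
    (\<exists>v. \<forall>t\<in>I. (q has_vector_derivative v t) (at t within I) \<and> v t \<in> EE k n (q t))"
    (is "_ \<longleftrightarrow> _ \<and> ?R")
proof -
  have "?R" if "\<forall>t\<in>I. (q has_vector_derivative
        ((\<Sum>i=0..n. u i t *\<^sub>R ZZ k i (q t)) + (\<Sum>r=1..k+1. w r t *\<^sub>R d_pt (n + 1) r)))
        (at t within I)" for u w
  proof (intro exI ballI conjI)
    fix t assume "t \<in> I"
    show "(q has_vector_derivative
        ((\<Sum>i=0..n. u i t *\<^sub>R ZZ k i (q t)) + (\<Sum>r=1..k+1. w r t *\<^sub>R d_pt (n + 1) r))) (at t within I)"
      using that \<open>t \<in> I\<close> by blast
    show "(\<Sum>i=0..n. u i t *\<^sub>R ZZ k i (q t)) + (\<Sum>r=1..k+1. w r t *\<^sub>R d_pt (n + 1) r) \<in> EE k n (q t)"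
      unfolding EE_def by (intro span_add span_sum span_scale span_base) auto
  qed
  moreover have "\<exists>u w. \<forall>t\<in>I. (q has_vector_derivative
        ((\<Sum>i=0..n. u i t *\<^sub>R ZZ k i (q t)) + (\<Sum>r=1..k+1. w r t *\<^sub>R d_pt (n + 1) r)))
        (at t within I)"
    if v: "\<forall>t\<in>I. (q has_vector_derivative v t) (at t within I) \<and> v t \<in> EE k n (q t)" for v
  proof -
    \<comment> \<open>The controls are chosen separately at each time; no regularity in
      \<open>t\<close> is asked of them.\<close>
    have "\<forall>t\<in>I. \<exists>u. \<forall>i\<le>n. pt (v t) i = u i *\<^sub>R link (q t) i"
      using that unfolding EE_iff[OF assms] by blast
    then obtain u where u: "\<And>t i. t \<in> I \<Longrightarrow> i \<le> n \<Longrightarrow> pt (v t) i = u t i *\<^sub>R link (q t) i"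
      unfolding bchoice_iff by blast
    have eq: "v t = (\<Sum>i=0..n. u t i *\<^sub>R ZZ k i (q t)) + (\<Sum>r=1..k+1. co (pt (v t) (n + 1)) r *\<^sub>R d_pt (n + 1) r)"
      if "t \<in> I" for t
      using u[OF that] by (rule eq_generator_sum[OF assms])
    show ?thesis
    proof (rule exI[of _ "\<lambda>i t. u t i"], rule exI[of _ "\<lambda>r t. co (pt (v t) (n + 1)) r"], rule ballI)
      fix t assume "t \<in> I"
      then show "(q has_vector_derivative
          ((\<Sum>i=0..n. u t i *\<^sub>R ZZ k i (q t)) + (\<Sum>r=1..k+1. co (pt (v t) (n + 1)) r *\<^sub>R d_pt (n + 1) r)))
          (at t within I)"
        unfolding eq[OF \<open>t \<in> I\<close>, symmetric] using v by blast
    qed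
  qed
  ultimately show ?thesis
    unfolding kinematic_evolution_def by blast
qed

section \<open>The distribution in a chart\<close>

text \<open>Coefficients are attached to indices instead of vectors, so \<open>f\<close> may repeat
  values.\<close>

lemma span_image_eq_sums:
  fixes f :: "nat \<Rightarrow> 'a::real_vector"
  assumes "finite J"
  shows "span (f ` J) = {v. \<exists>c. v = (\<Sum>j\<in>J. c j *\<^sub>R f j)}"
proof
  show "span (f ` J) \<subseteq> {v. \<exists>c. v = (\<Sum>j\<in>J. c j *\<^sub>R f j)}"
  proof (rule span_minimal)
    show "f ` J \<subseteq> {v. \<exists>c. v = (\<Sum>j\<in>J. c j *\<^sub>R f j)}"
    proof (clarsimp)
      fix i assume "i \<in> J"
      then have "f i = (\<Sum>j\<in>J. (if j = i then 1 else 0) *\<^sub>R f j)"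
        using assms by (simp add: if_distrib[of "\<lambda>c. c *\<^sub>R _"] cong: if_cong)
      then show "\<exists>c. f i = (\<Sum>j\<in>J. c j *\<^sub>R f j)"
        by (rule exI[where x = "\<lambda>j. if j = i then 1 else 0"])
    qed
    show "subspace {v. \<exists>c. v = (\<Sum>j\<in>J. c j *\<^sub>R f j)}"
    proof (rule subspaceI)
      have "0 = (\<Sum>j\<in>J. 0 *\<^sub>R f j)" by simp
      then show "0 \<in> {v. \<exists>c. v = (\<Sum>j\<in>J. c j *\<^sub>R f j)}"
        by (intro CollectI exI[of _ "\<lambda>_. 0"])
    next
      fix x y assume "x \<in> {v. \<exists>c. v = (\<Sum>j\<in>J. c j *\<^sub>R f j)}" "y \<in> {v. \<exists>c. v = (\<Sum>j\<in>J. c j *\<^sub>R f j)}"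
      then obtain c d where "x = (\<Sum>j\<in>J. c j *\<^sub>R f j)" "y = (\<Sum>j\<in>J. d j *\<^sub>R f j)" by blast
      then have "x + y = (\<Sum>j\<in>J. (c j + d j) *\<^sub>R f j)" by (simp add: scaleR_left_distrib sum.distrib)
      then show "x + y \<in> {v. \<exists>c. v = (\<Sum>j\<in>J. c j *\<^sub>R f j)}"
        by (intro CollectI exI[of _ "\<lambda>j. c j + d j"])
    next
      fix a x assume "x \<in> {v. \<exists>c. v = (\<Sum>j\<in>J. c j *\<^sub>R f j)}"
      then obtain c where "x = (\<Sum>j\<in>J. c j *\<^sub>R f j)" by blast
      then have "a *\<^sub>R x = (\<Sum>j\<in>J. (a * c j) *\<^sub>R f j)" by (simp add: scaleR_sum_right)
      then show "a *\<^sub>R x \<in> {v. \<exists>c. v = (\<Sum>j\<in>J. c j *\<^sub>R f j)}"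
        by (intro CollectI exI[of _ "\<lambda>j. a * c j"])
    qed
  qed
  show "{v. \<exists>c. v = (\<Sum>j\<in>J. c j *\<^sub>R f j)} \<subseteq> span (f ` J)"
    by clarify (intro span_sum span_scale span_base imageI)
qed

section \<open>The linear isomorphism \<open>Gam\<close>\<close>

lemma pt_Gam:
  assumes "i < CARD('p)"
  shows "pt (Gam q :: ('m::enum, 'p::enum) arm) i = (if i = 0 then pt q 0 else pt q i - pt q (i - 1))"
  using assms by (simp add: Gam_def pt_of_pts)

lemma pt_Gam_Suc: "Suc i < CARD('p) \<Longrightarrow> pt (Gam q :: ('m::enum, 'p::enum) arm) (Suc i) = link q i"
  by (simp add: pt_Gam link_def)

lemma linear_Gam: "linear (Gam :: ('m::enum, 'p::enum) arm \<Rightarrow> _)"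
proof
  show "Gam (p + q) = Gam p + Gam q" for p q :: "('m, 'p) arm"
    by (rule arm_eqI) (simp add: pt_Gam pt_linear)
  show "Gam (c *\<^sub>R q) = c *\<^sub>R Gam q" for c and q :: "('m, 'p) arm"
    by (rule arm_eqI) (simp add: pt_Gam pt_linear algebra_simps)
qed

lemma frechet_derivative_Gam: "frechet_derivative Gam (at q) = (Gam :: ('m::enum, 'p::enum) arm \<Rightarrow> _)"
  using frechet_derivative_at[OF bounded_linear_imp_has_derivative[OF
      linear_conv_bounded_linear[THEN iffD1, OF linear_Gam]]] by metis

definition Gam_inv :: "('m::enum, 'p::enum) arm \<Rightarrow> ('m, 'p) arm" where
  "Gam_inv p = of_pts (\<lambda>i. pt p 0 + (\<Sum>j<i. pt p (Suc j)))"

lemma pt_Gam_inv: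
  "i < CARD('p) \<Longrightarrow> pt (Gam_inv p :: ('m::enum, 'p::enum) arm) i = pt p 0 + (\<Sum>j<i. pt p (Suc j))"
  by (simp add: Gam_inv_def pt_of_pts)

lemma Gam_Gam_inv: "Gam (Gam_inv p) = (p :: ('m::enum, 'p::enum) arm)"
proof (rule arm_eqI)
  fix i assume "i < CARD('p)"
  then show "pt (Gam (Gam_inv p)) i = pt p i"
    by (cases i) (simp_all add: pt_Gam pt_Gam_inv)
qed

lemma inj_Gam: "inj (Gam :: ('m::enum, 'p::enum) arm \<Rightarrow> _)"
proof (rule injI)
  fix p q :: "('m, 'p) arm" assume eq: "Gam p = Gam q"
  have "pt p i = pt q i" if "i < CARD('p)" for i
    using that
  proof (induction i)
    case 0
    then show ?case using pt_Gam[of 0 p] pt_Gam[of 0 q] eq by simp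
  next
    case (Suc i)
    then show ?case using pt_Gam[of "Suc i" p] pt_Gam[of "Suc i" q] eq by simp
  qed
  then show "p = q" by (rule arm_eqI)
qed

text \<open>Injectivity leaves a single preimage in the union, and the linear map \<open>Gam\<close>
  is its own derivative.\<close>

lemma image_distribution_Gam:
  fixes q :: "('m::enum, 'p::enum) arm"
  assumes "q \<in> M"
  shows "image_distribution Gam M D (Gam q) = Gam ` D q"
proof -
  have "{q' \<in> M. Gam q' = Gam q} = {q}"
    using assms by (auto dest: injD[OF inj_Gam])
  then show ?thesis by (simp add: image_distribution_def frechet_derivative_Gam)
qed

lemma pt_chart_pt:
  "i < CARD('p) \<Longrightarrow> pt (chart_pt \<Phi> x \<theta> :: ('m::enum, 'p::enum) arm) i =
    (if i = 0 then x else \<Phi> (i - 1) (\<theta> (i - 1)))"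
  by (simp add: chart_pt_def pt_of_pts)

lemma Delta_iff:
  fixes q :: "('m::enum, 'p::enum) arm"
  assumes "CARD('m) = k + 1" "CARD('p) = n + 2" "q \<in> Conf n"
  shows "v \<in> Delta k n q \<longleftrightarrow>
    (\<exists>u. \<forall>i\<le>n. pt v i = u i *\<^sub>R link q i) \<and> (\<forall>i\<le>n. (pt v (Suc i) - pt v i) \<bullet> link q i = 0)"
  by (auto simp: Delta_def tangent_space_Conf[OF assms(2,3)] EE_iff[OF assms(1,2)] link_def[of v])

section \<open>Propagation of velocities along the arm\<close>

locale arm_charts =
  fixes k n :: nat and \<Phi> :: "nat \<Rightarrow> (nat \<Rightarrow> real) \<Rightarrow> real ^ 'm::enum"
  assumes card_coords: "CARD('m) = k + 1" and k_pos: "1 \<le> k" and charts: "hyper_charts k n \<Phi>"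
begin

lemma sphere_chart: "i \<le> n \<Longrightarrow> sphere_chart k (\<Phi> i)"
  using charts card_coords k_pos
  by (auto simp: hyper_charts_def hyper_chart_def sphere_chart_def)

lemma A_fun_eq: "1 \<le> i \<Longrightarrow> i \<le> n \<Longrightarrow> A_fun k n \<Phi> \<theta> i = \<Phi> (i - 1) (\<theta> (i - 1)) \<bullet> \<Phi> i (\<theta> i)"
  unfolding inner_eq_sum_co card_coords by (simp add: A_fun_def)

text \<open>The first partial derivative has norm one, so the separate case \<open>j = 1\<close> of
  \<open>B_fun\<close> merges with the general quotient.\<close>

lemma B_fun_eq:
  assumes "i < n" "j \<in> {1..k}"
  shows "B_fun k \<Phi> \<theta> (Suc i) j = (\<Phi> (Suc i) (\<theta> (Suc i)) \<bullet> chart_deriv (\<Phi> i) (\<theta> i) j) /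
    (norm (chart_deriv (\<Phi> i) (\<theta> i) j))\<^sup>2"
proof -
  interpret sphere_chart k "\<Phi> i" using sphere_chart assms by simp
  have d: "d_phi (\<Phi> i) (\<theta> i) j = co (chart_deriv (\<Phi> i) (\<theta> i) j)"
    using assms by (intro ext d_phi_eq) auto
  have s: "(\<Sum>r=1..k+1. co (chart_deriv (\<Phi> i) (\<theta> i) j) r * co (\<Phi> (Suc i) (\<theta> (Suc i))) r) =
      \<Phi> (Suc i) (\<theta> (Suc i)) \<bullet> chart_deriv (\<Phi> i) (\<theta> i) j"
    unfolding inner_eq_sum_co card_coords
    by (rule sum.cong) (simp_all add: mult.commute)
  show ?thesis
    using norm_chart_deriv_1 unfolding B_fun_def diff_Suc_1 d Let_def s of_cos_co by simp
qed

text \<open>Expand link \<open>Suc i\<close> in the frame at link \<open>i\<close>: the normal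
  coefficient is \<open>A_fun\<close>, and the sum is the tangential remainder.\<close>

lemma sum_B_fun:
  assumes "i < n" "regular_angles k (\<theta> i)"
  shows "(\<Sum>j=1..k. B_fun k \<Phi> \<theta> (Suc i) j *\<^sub>R chart_deriv (\<Phi> i) (\<theta> i) j) =
    \<Phi> (Suc i) (\<theta> (Suc i)) - A_fun k n \<Phi> \<theta> (Suc i) *\<^sub>R \<Phi> i (\<theta> i)"
proof -
  interpret sphere_chart k "\<Phi> i" using sphere_chart assms by simp
  have "(\<Sum>j=1..k. B_fun k \<Phi> \<theta> (Suc i) j *\<^sub>R chart_deriv (\<Phi> i) (\<theta> i) j) =
      (\<Sum>j=1..k. ((\<Phi> (Suc i) (\<theta> (Suc i)) \<bullet> chart_deriv (\<Phi> i) (\<theta> i) j) /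
        (norm (chart_deriv (\<Phi> i) (\<theta> i) j))\<^sup>2) *\<^sub>R chart_deriv (\<Phi> i) (\<theta> i) j)"
    using assms by (intro sum.cong) (simp_all add: B_fun_eq)
  moreover have "A_fun k n \<Phi> \<theta> (Suc i) = \<Phi> (Suc i) (\<theta> (Suc i)) \<bullet> \<Phi> i (\<theta> i)"
    using assms by (simp add: A_fun_eq inner_commute)
  ultimately show ?thesis
    using chart_frame_expansion[OF assms(2), of "\<Phi> (Suc i) (\<theta> (Suc i))"] by (simp add: algebra_simps)
qed

lemma vel_last: "vel k n \<Phi> \<theta> c n = c"
  by (simp add: vel_def)

lemma vel_Suc: "i < n \<Longrightarrow> vel k n \<Phi> \<theta> c i = vel k n \<Phi> \<theta> c (Suc i) * A_fun k n \<Phi> \<theta> (Suc i)"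
  by (simp add: vel_def prod.atLeast_Suc_atMost[of "Suc i"])

lemma vel_eq_mult: "vel k n \<Phi> \<theta> c i = c * vel k n \<Phi> \<theta> 1 i"
  by (simp add: vel_def)

text \<open>The recursion determines each speed from the next one, so the induction descends from
  \<open>n\<close>.\<close>

lemma vel_unique:
  assumes "\<And>i. i < n \<Longrightarrow> u i = u (Suc i) * A_fun k n \<Phi> \<theta> (Suc i)" "i \<le> n"
  shows "u i = vel k n \<Phi> \<theta> (u n) i"
  using assms(2)
proof (induction rule: inc_induct)
  case base
  then show ?case by (simp add: vel_last)
next
  case (step i)
  then show ?case using assms(1)[of i] by (simp add: vel_Suc)
qed

text \<open>For \<open>i < n\<close>, taking the inner product with link \<open>i\<close> turns
  rigidity into the recursion for the speeds, solved by \<open>vel\<close>. For \<open>i = n\<close>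
  the velocity of the end point is not tied to a further link, so that one condition
  remains.\<close>

lemma admissible_velocities_iff:
  "(\<exists>u. \<forall>i\<le>n. V i = u i *\<^sub>R \<Phi> i (\<theta> i)) \<and> (\<forall>i\<le>n. (V (Suc i) - V i) \<bullet> \<Phi> i (\<theta> i) = 0) \<longleftrightarrow>
   (\<exists>c. \<forall>i\<le>n. V i = vel k n \<Phi> \<theta> c i *\<^sub>R \<Phi> i (\<theta> i)) \<and> (V (Suc n) - V n) \<bullet> \<Phi> n (\<theta> n) = 0"
  (is "?L \<longleftrightarrow> ?R")
proof
  have unit: "\<Phi> i (\<theta> i) \<bullet> \<Phi> i (\<theta> i) = 1" if "i \<le> n" for i
    using sphere_chart.inner_chart_self[OF sphere_chart[OF that]] .
  have A: "\<Phi> (Suc i) (\<theta> (Suc i)) \<bullet> \<Phi> i (\<theta> i) = A_fun k n \<Phi> \<theta> (Suc i)" if "i < n" for i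
    using that by (simp add: A_fun_eq inner_commute)
  {
    assume ?L
    then obtain u where u: "\<And>i. i \<le> n \<Longrightarrow> V i = u i *\<^sub>R \<Phi> i (\<theta> i)"
      and orth: "\<And>i. i \<le> n \<Longrightarrow> (V (Suc i) - V i) \<bullet> \<Phi> i (\<theta> i) = 0" by blast
    have "u i = u (Suc i) * A_fun k n \<Phi> \<theta> (Suc i)" if "i < n" for i
      using orth[of i] u[of i] u[of "Suc i"] that by (simp add: inner_diff_left unit A)
    then have "V i = vel k n \<Phi> \<theta> (u n) i *\<^sub>R \<Phi> i (\<theta> i)" if "i \<le> n" for i
      using u[OF that] vel_unique[of u, OF _ that] by simp
    then show ?R using orth[of n] by blast
  next
    assume ?R
    then obtain c where c: "\<And>i. i \<le> n \<Longrightarrow> V i = vel k n \<Phi> \<theta> c i *\<^sub>R \<Phi> i (\<theta> i)"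
      and orth: "(V (Suc n) - V n) \<bullet> \<Phi> n (\<theta> n) = 0" by blast
    have "(V (Suc i) - V i) \<bullet> \<Phi> i (\<theta> i) = 0" if "i \<le> n" for i
    proof (cases "i = n")
      case False
      then have "i < n" using that by simp
      then show ?thesis
        using c[of i] c[of "Suc i"] by (simp add: inner_diff_left unit A vel_Suc)
    qed (simp add: orth)
    then show ?L using c by blast
  }
qed

lemma vel_increment:
  assumes "i < n" "regular_angles k (\<theta> i)"
  shows "vel k n \<Phi> \<theta> c (Suc i) *\<^sub>R (\<Sum>j=1..k. B_fun k \<Phi> \<theta> (Suc i) j *\<^sub>R chart_deriv (\<Phi> i) (\<theta> i) j) =
    vel k n \<Phi> \<theta> c (Suc i) *\<^sub>R \<Phi> (Suc i) (\<theta> (Suc i)) - vel k n \<Phi> \<theta> c i *\<^sub>R \<Phi> i (\<theta> i)"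
  unfolding sum_B_fun[where \<theta> = \<theta>, OF assms] vel_Suc[OF assms(1)] by (simp add: scaleR_diff_right)

text \<open>Passes from the velocities of points to those of links, the form in which
  \<open>Gam\<close> presents them. Backwards, the increments telescope from
  \<open>V 0\<close>.\<close>

lemma velocities_iff_increments:
  assumes "\<And>i. i < n \<Longrightarrow> regular_angles k (\<theta> i)"
  shows "(\<forall>i\<le>n. V i = vel k n \<Phi> \<theta> c i *\<^sub>R \<Phi> i (\<theta> i)) \<longleftrightarrow>
    V 0 = vel k n \<Phi> \<theta> c 0 *\<^sub>R \<Phi> 0 (\<theta> 0) \<and>
    (\<forall>i<n. V (Suc i) - V i = vel k n \<Phi> \<theta> c (Suc i) *\<^sub>R
      (\<Sum>j=1..k. B_fun k \<Phi> \<theta> (Suc i) j *\<^sub>R chart_deriv (\<Phi> i) (\<theta> i) j))"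
  (is "?L \<longleftrightarrow> ?R")
proof
  have inc: "vel k n \<Phi> \<theta> c (Suc i) *\<^sub>R (\<Sum>j=1..k. B_fun k \<Phi> \<theta> (Suc i) j *\<^sub>R chart_deriv (\<Phi> i) (\<theta> i) j) =
      vel k n \<Phi> \<theta> c (Suc i) *\<^sub>R \<Phi> (Suc i) (\<theta> (Suc i)) - vel k n \<Phi> \<theta> c i *\<^sub>R \<Phi> i (\<theta> i)" if "i < n" for i
    by (rule vel_increment[where \<theta> = \<theta>, OF that assms[OF that]])
  show ?R if ?L
    using that inc by auto
  show ?L if ?R
  proof (intro allI impI)
    fix i assume "i \<le> n"
    then show "V i = vel k n \<Phi> \<theta> c i *\<^sub>R \<Phi> i (\<theta> i)"
    proof (induction i)
      case (Suc i)
      have "V (Suc i) - V i = vel k n \<Phi> \<theta> c (Suc i) *\<^sub>R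
          (\<Sum>j=1..k. B_fun k \<Phi> \<theta> (Suc i) j *\<^sub>R chart_deriv (\<Phi> i) (\<theta> i) j)"
        using \<open>?R\<close> Suc.prems by simp
      also have "\<dots> = vel k n \<Phi> \<theta> c (Suc i) *\<^sub>R \<Phi> (Suc i) (\<theta> (Suc i)) - V i"
        using Suc inc[of i] by simp
      finally show ?case by simp
    qed (use that in simp)
  qed
qed

section \<open>Coordinate fields of the chart and the fields generating the distribution\<close>

lemma pt_d_x:
  assumes "m < CARD('p)"
  shows "pt (d_x \<Phi> x \<theta> r :: ('m, 'p::enum) arm) m = (if m = 0 then unit_vec r else 0)"
proof -
  have "((\<lambda>s. chart_pt \<Phi> (x + s *\<^sub>R unit_vec r) \<theta> :: ('m, 'p) arm) has_vector_derivative
      axis (ix 0) (unit_vec r)) (at 0)"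
  proof (rule has_vector_derivative_arm_iff[THEN iffD2], intro allI impI)
    fix i assume "i < CARD('p)"
    moreover have "((\<lambda>s. x + s *\<^sub>R unit_vec r) has_vector_derivative unit_vec r) (at 0)"
      by (auto intro!: derivative_eq_intros)
    ultimately show "((\<lambda>s. pt (chart_pt \<Phi> (x + s *\<^sub>R unit_vec r) \<theta> :: ('m, 'p) arm) i) has_vector_derivative
        pt (axis (ix 0) (unit_vec r) :: ('m, 'p) arm) i) (at 0)"
      by (cases "i = 0") (simp_all add: pt_chart_pt pt_axis)
  qed
  then show ?thesis
    unfolding d_x_def by (subst vector_derivative_at, assumption) (use assms in \<open>simp add: pt_axis\<close>)
qed

text \<open>The angles of link \<open>i\<close> act on block \<open>Suc i\<close>, since block 0 is
  occupied by the position of the first point.\<close>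

lemma pt_d_theta:
  assumes card_pts: "CARD('p) = n + 2" and "i \<le> n" "j \<in> {1..k}" "m \<le> n + 1"
  shows "pt (d_theta \<Phi> x \<theta> i j :: ('m, 'p::enum) arm) m = (if m = Suc i then chart_deriv (\<Phi> i) (\<theta> i) j else 0)"
proof -
  interpret sphere_chart k "\<Phi> i" using sphere_chart assms by simp
  have "((\<lambda>s. chart_pt \<Phi> x (\<theta>(i := (\<theta> i)(j := s))) :: ('m, 'p) arm) has_vector_derivative
      axis (ix (Suc i)) (chart_deriv (\<Phi> i) (\<theta> i) j)) (at (\<theta> i j))"
  proof (rule has_vector_derivative_arm_iff[THEN iffD2], intro allI impI)
    fix l assume "l < CARD('p)"
    then show "((\<lambda>s. pt (chart_pt \<Phi> x (\<theta>(i := (\<theta> i)(j := s))) :: ('m, 'p) arm) l) has_vector_derivative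
        pt (axis (ix (Suc i)) (chart_deriv (\<Phi> i) (\<theta> i) j) :: ('m, 'p) arm) l) (at (\<theta> i j))"
      using assms has_vector_derivative_chart_deriv[of j "\<theta> i"]
      by (cases "l = Suc i"; cases l) (auto simp: pt_chart_pt pt_axis)
  qed
  then show ?thesis
    unfolding d_theta_def by (subst vector_derivative_at, assumption) (use assms in \<open>simp add: pt_axis\<close>)
qed

text \<open>\<open>Z_field\<close> of index \<open>i\<close> uses the angles of link
  \<open>i - 1\<close>, so after the shift it lives in block \<open>i\<close> alone.\<close>

lemma pt_Z_field:
  assumes "CARD('p) = n + 2" "i \<le> n" "m \<le> n + 1"
  shows "pt (Z_field k \<Phi> x \<theta> i :: ('m, 'p::enum) arm) m =
    (if m \<noteq> i then 0 else if i = 0 then \<Phi> 0 (\<theta> 0)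
     else (\<Sum>j=1..k. B_fun k \<Phi> \<theta> i j *\<^sub>R chart_deriv (\<Phi> (i - 1)) (\<theta> (i - 1)) j))"
proof (cases i)
  case 0
  have "(\<Sum>r=1..k+1. co (\<Phi> 0 (\<theta> 0)) r *\<^sub>R unit_vec r) = \<Phi> 0 (\<theta> 0)"
    using sum_co_unit_vec[of "\<Phi> 0 (\<theta> 0)"] by (simp only: card_coords)
  moreover have "pt (Z_field k \<Phi> x \<theta> i :: ('m, 'p) arm) m =
      (\<Sum>r=1..k+1. if m = 0 then co (\<Phi> 0 (\<theta> 0)) r *\<^sub>R unit_vec r else 0)"
    unfolding Z_field_def using 0 assms
    by (simp only: simp_thms if_True pt_sum) (intro sum.cong, auto simp: pt_scaleR pt_d_x)
  ultimately show ?thesis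
    using 0 by (cases "m = 0") auto
next
  case (Suc l)
  have "pt (Z_field k \<Phi> x \<theta> i :: ('m, 'p) arm) m =
      (\<Sum>j=1..k. if m = i then B_fun k \<Phi> \<theta> i j *\<^sub>R chart_deriv (\<Phi> l) (\<theta> l) j else 0)"
    unfolding Z_field_def using Suc assms
    by (simp only: nat.simps if_False pt_sum diff_Suc_1) (intro sum.cong, auto simp: pt_scaleR pt_d_theta)
  then show ?thesis
    using Suc by (cases "m = i") auto
qed

text \<open>Identifies the weights in \<open>X_field\<close> with the speeds produced by the unit
  control.\<close>

lemma f_fun_eq_vel: "i \<le> n \<Longrightarrow> f_fun k n \<Phi> \<theta> n i = vel k n \<Phi> \<theta> 1 i"
  by (simp add: f_fun_def vel_def)

lemma pt_X_field_0:
  assumes "CARD('p) = n + 2" "m \<le> n + 1"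
  shows "pt (X_field k n \<Phi> x \<theta> n 0 :: ('m, 'p::enum) arm) m =
    (if m = 0 then vel k n \<Phi> \<theta> 1 0 *\<^sub>R \<Phi> 0 (\<theta> 0)
     else if m \<le> n then vel k n \<Phi> \<theta> 1 m *\<^sub>R
       (\<Sum>j=1..k. B_fun k \<Phi> \<theta> m j *\<^sub>R chart_deriv (\<Phi> (m - 1)) (\<theta> (m - 1)) j)
     else 0)"
proof -
  have "pt (X_field k n \<Phi> x \<theta> n 0 :: ('m, 'p) arm) m =
      (\<Sum>i=0..n. if i = m then vel k n \<Phi> \<theta> 1 i *\<^sub>R (if i = 0 then \<Phi> 0 (\<theta> 0)
     else (\<Sum>j=1..k. B_fun k \<Phi> \<theta> i j *\<^sub>R chart_deriv (\<Phi> (i - 1)) (\<theta> (i - 1)) j)) else 0)"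
    unfolding X_field_def using assms
    by (simp only: simp_thms if_True pt_sum) (intro sum.cong, auto simp: pt_scaleR pt_Z_field f_fun_eq_vel)
  then show ?thesis
    using assms by simp
qed

text \<open>The coefficient \<open>c\<close> of the field of index 0 fixes blocks 0 to
  \<open>n\<close>; the remaining \<open>k\<close> fields act only on block \<open>Suc n\<close>,
  which that field leaves at zero.\<close>

lemma Delta_n_iff:
  assumes "CARD('p) = n + 2"
  shows "(y :: ('m, 'p::enum) arm) \<in> Delta_n k n \<Phi> x \<theta> \<longleftrightarrow>
    (\<exists>c. pt y 0 = vel k n \<Phi> \<theta> c 0 *\<^sub>R \<Phi> 0 (\<theta> 0) \<and>
      (\<forall>i<n. pt y (Suc i) = vel k n \<Phi> \<theta> c (Suc i) *\<^sub>R
        (\<Sum>j=1..k. B_fun k \<Phi> \<theta> (Suc i) j *\<^sub>R chart_deriv (\<Phi> i) (\<theta> i) j))) \<and>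
    pt y (Suc n) \<in> span (chart_deriv (\<Phi> n) (\<theta> n) ` {1..k})"
    (is "_ \<longleftrightarrow> ?R")
proof -
  have comb: "pt (\<Sum>j=0..k. d j *\<^sub>R X_field k n \<Phi> x \<theta> n j :: ('m, 'p) arm) m =
      (if m = 0 then vel k n \<Phi> \<theta> (d 0) 0 *\<^sub>R \<Phi> 0 (\<theta> 0)
       else if m \<le> n then vel k n \<Phi> \<theta> (d 0) m *\<^sub>R
         (\<Sum>j=1..k. B_fun k \<Phi> \<theta> m j *\<^sub>R chart_deriv (\<Phi> (m - 1)) (\<theta> (m - 1)) j)
       else (\<Sum>j=1..k. d j *\<^sub>R chart_deriv (\<Phi> n) (\<theta> n) j))" if "m \<le> n + 1" for d m
  proof -
    have "pt (\<Sum>j=1..k. d j *\<^sub>R X_field k n \<Phi> x \<theta> n j :: ('m, 'p) arm) m =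
        (\<Sum>j=1..k. if m = Suc n then d j *\<^sub>R chart_deriv (\<Phi> n) (\<theta> n) j else 0)"
      unfolding pt_sum using assms that
      by (intro sum.cong) (auto simp: pt_scaleR X_field_def pt_d_theta)
    moreover have "(\<Sum>j=0..k. d j *\<^sub>R X_field k n \<Phi> x \<theta> n j :: ('m, 'p) arm) =
        d 0 *\<^sub>R X_field k n \<Phi> x \<theta> n 0 + (\<Sum>j=1..k. d j *\<^sub>R X_field k n \<Phi> x \<theta> n j)"
      by (simp add: sum.atLeast_Suc_atMost)
    ultimately show ?thesis
      using that unfolding vel_eq_mult[of _ "d 0"]
      by (auto simp: pt_add pt_scaleR pt_X_field_0[OF assms])
  qed
  show ?thesis
  proof
    assume "y \<in> Delta_n k n \<Phi> x \<theta>"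
    then obtain d where d: "y = (\<Sum>j=0..k. d j *\<^sub>R X_field k n \<Phi> x \<theta> n j)"
      unfolding Delta_n_def span_image_eq_sums[OF finite_atLeastAtMost] by blast
    show ?R
      unfolding d by (auto simp: comb span_image_eq_sums)
  next
    assume ?R
    then obtain c d where c: "pt y 0 = vel k n \<Phi> \<theta> c 0 *\<^sub>R \<Phi> 0 (\<theta> 0)"
      "\<And>i. i < n \<Longrightarrow> pt y (Suc i) = vel k n \<Phi> \<theta> c (Suc i) *\<^sub>R
        (\<Sum>j=1..k. B_fun k \<Phi> \<theta> (Suc i) j *\<^sub>R chart_deriv (\<Phi> i) (\<theta> i) j)"
      and d: "pt y (Suc n) = (\<Sum>j=1..k. d j *\<^sub>R chart_deriv (\<Phi> n) (\<theta> n) j)"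
      unfolding span_image_eq_sums[OF finite_atLeastAtMost] by blast
    have "y = (\<Sum>j=0..k. (if j = 0 then c else d j) *\<^sub>R X_field k n \<Phi> x \<theta> n j)"
    proof (rule arm_eqI)
      fix m assume "m < CARD('p)"
      then have m: "m \<le> n + 1" using assms by simp
      have "(\<Sum>j=1..k. (if j = 0 then c else d j) *\<^sub>R chart_deriv (\<Phi> n) (\<theta> n) j) =
          (\<Sum>j=1..k. d j *\<^sub>R chart_deriv (\<Phi> n) (\<theta> n) j)"
        by (intro sum.cong) auto
      then show "pt y m = pt (\<Sum>j=0..k. (if j = 0 then c else d j) *\<^sub>R X_field k n \<Phi> x \<theta> n j :: ('m, 'p) arm) m"
        unfolding comb[OF m] using m c(1) c(2)[of "m - 1"] d by (cases m) (auto simp: le_Suc_eq)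
    qed
    then show "y \<in> Delta_n k n \<Phi> x \<theta>"
      unfolding Delta_n_def span_image_eq_sums[OF finite_atLeastAtMost] by (intro CollectI exI)
  qed
qed

text \<open>Charts take values of norm one, so the link lengths come for free from the chart
  representation.\<close>

lemma Conf_chart:
  fixes q :: "('m, 'p::enum) arm"
  assumes "CARD('p) = n + 2" "Gam q = chart_pt \<Phi> x \<theta>"
  shows "pt q 0 = x" "i \<le> n \<Longrightarrow> link q i = \<Phi> i (\<theta> i)" "q \<in> Conf n"
proof -
  show "pt q 0 = x"
    using pt_Gam[of 0 q] pt_chart_pt[of 0 \<Phi> x \<theta>, where ?'p = 'p] assms by simp
  have link: "link q i = \<Phi> i (\<theta> i)" if "i \<le> n" for i
    using pt_Gam_Suc[of i q] pt_chart_pt[of "Suc i" \<Phi> x \<theta>, where ?'p = 'p] assms that by simp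
  then show "i \<le> n \<Longrightarrow> link q i = \<Phi> i (\<theta> i)" .
  show "q \<in> Conf n"
    using link sphere_chart.norm_chart[OF sphere_chart] by (simp add: Conf_iff)
qed

text \<open>Both sides are compared through \<open>Gam\<close>: the velocity conditions at the
  preimage of the chart point, rewritten as increments, are those of \<open>Delta_n_iff\<close> for
  the image vector.\<close>

lemma Delta_n_eq_image:
  assumes card_pts: "CARD('p) = n + 2" and reg: "\<And>i. i \<le> n \<Longrightarrow> regular_angles k (\<theta> i)"
  shows "(Delta_n k n \<Phi> x \<theta> :: ('m, 'p::enum) arm set) =
    image_distribution Gam (Conf n) (Delta k n) (chart_pt \<Phi> x \<theta>)"
proof -
  define q :: "('m, 'p) arm" where "q = Gam_inv (chart_pt \<Phi> x \<theta>)"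
  have Gam_q: "Gam q = chart_pt \<Phi> x \<theta>" by (simp add: q_def Gam_Gam_inv)
  note q = Conf_chart[OF card_pts Gam_q]
  have "v \<in> Delta k n q \<longleftrightarrow> Gam v \<in> Delta_n k n \<Phi> x \<theta>" for v :: "('m, 'p) arm"
  proof -
    have inc: "(\<forall>i\<le>n. pt v i = vel k n \<Phi> \<theta> c i *\<^sub>R \<Phi> i (\<theta> i)) \<longleftrightarrow>
      pt v 0 = vel k n \<Phi> \<theta> c 0 *\<^sub>R \<Phi> 0 (\<theta> 0) \<and>
      (\<forall>i<n. pt v (Suc i) - pt v i = vel k n \<Phi> \<theta> c (Suc i) *\<^sub>R
        (\<Sum>j=1..k. B_fun k \<Phi> \<theta> (Suc i) j *\<^sub>R chart_deriv (\<Phi> i) (\<theta> i) j))" for c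
      using reg by (intro velocities_iff_increments) simp
    have "v \<in> Delta k n q \<longleftrightarrow> (\<exists>u. \<forall>i\<le>n. pt v i = u i *\<^sub>R \<Phi> i (\<theta> i)) \<and>
        (\<forall>i\<le>n. (pt v (Suc i) - pt v i) \<bullet> \<Phi> i (\<theta> i) = 0)"
      unfolding Delta_iff[OF card_coords card_pts q(3)] by (simp add: q(2))
    also have "\<dots> \<longleftrightarrow> (\<exists>c. \<forall>i\<le>n. pt v i = vel k n \<Phi> \<theta> c i *\<^sub>R \<Phi> i (\<theta> i)) \<and>
        pt v (Suc n) - pt v n \<in> span (chart_deriv (\<Phi> n) (\<theta> n) ` {1..k})"
      unfolding admissible_velocities_iff sphere_chart.span_chart_deriv[OF sphere_chart[OF order_refl] reg[OF order_refl]]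
      by simp
    also have "\<dots> \<longleftrightarrow> Gam v \<in> Delta_n k n \<Phi> x \<theta>"
      unfolding Delta_n_iff[OF card_pts] inc by (simp add: card_pts pt_Gam)
    finally show ?thesis .
  qed
  then have "Gam ` Delta k n q = (Delta_n k n \<Phi> x \<theta> :: ('m, 'p) arm set)"
    \<comment> \<open>Surjectivity of \<open>Gam\<close> turns the equivalence for \<open>v\<close>
      into equality of the two sets.\<close>
    by (auto simp: image_iff) (metis Gam_Gam_inv)
  then show ?thesis
    using image_distribution_Gam[OF q(3)] by (simp add: Gam_q)
qed

end

section \<open>Charts through every point of \<open>SS\<close>\<close>

text \<open>The angles all equal to \<open>pi / 2\<close> lie in the domain, and for each link some
  orthogonal map carries that point of the unit sphere to the given link.\<close>

lemma exists_hyper_charts: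
  fixes p :: "('m::enum, 'p::enum) arm"
  assumes "CARD('m) = k + 1" "CARD('p) = n + 2" "p \<in> SS n"
  shows "\<exists>\<Phi> x \<theta>. hyper_charts k n \<Phi> \<and> \<theta> \<in> angle_dom k n \<and> chart_pt \<Phi> x \<theta> = p"
proof -
  have norm1: "norm (hyper k \<alpha> :: real ^ 'm::enum) = 1" for \<alpha>
    by (rule norm_hyper[OF assms(1)])
  have "\<exists>R :: real ^ 'm::enum \<Rightarrow> real ^ 'm::enum. orthogonal_transformation R \<and> R (hyper k (\<lambda>_. pi / 2)) = pt p (Suc i)" if "i \<le> n" for i
  proof -
    have "norm (pt p (Suc i)) = 1" using assms(3) that by (simp add: SS_def)
    then show ?thesis
      using norm1 by (metis orthogonal_transformation_exists_1)
  qed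
  then obtain R :: "nat \<Rightarrow> real ^ 'm::enum \<Rightarrow> real ^ 'm::enum"
    where R: "\<And>i. i \<le> n \<Longrightarrow> orthogonal_transformation (R i)"
    "\<And>i. i \<le> n \<Longrightarrow> R i (hyper k (\<lambda>_. pi / 2)) = pt p (Suc i)" by metis
  define \<Phi> where "\<Phi> i \<alpha> = R i (hyper k \<alpha>)" for i \<alpha>
  have "hyper_charts k n \<Phi>"
    unfolding hyper_charts_def
  proof
    fix i assume "i \<in> {0..n}"
    then have R_i: "orthogonal_transformation (R i)" using R(1) by simp
    moreover have "\<Phi> i = (\<lambda>\<alpha>. R i (hyper k \<alpha>))" by (rule ext) (rule \<Phi>_def)
    \<comment> \<open>The base point of the chart is read off afterwards as its value at zero
      angles; it need not be the given link.\<close>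
    ultimately have "hyper_chart k (\<Phi> i (\<lambda>_. 0)) (\<Phi> i)"
      unfolding hyper_chart_def by (intro conjI exI[of _ "R i"] refl)
    moreover have "norm (\<Phi> i (\<lambda>_. 0)) = 1"
      unfolding \<Phi>_def by (simp add: orthogonal_transformation_norm[OF R_i] norm1)
    ultimately show "\<exists>\<alpha>\<in>sphere 0 1. hyper_chart k \<alpha> (\<Phi> i)" by auto
  qed
  moreover have "(\<lambda>_ _. pi / 2) \<in> angle_dom k n"
    by (simp add: angle_dom_def)
  moreover have "chart_pt \<Phi> (pt p 0) (\<lambda>_ _. pi / 2) = p"
  proof (rule arm_eqI)
    fix i assume "i < CARD('p)"
    then show "pt (chart_pt \<Phi> (pt p 0) (\<lambda>_ _. pi / 2) :: ('m, 'p) arm) i = pt p i"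
      using assms(2) by (cases i) (simp_all add: pt_chart_pt \<Phi>_def R(2))
  qed
  ultimately show ?thesis by blast
qed

section \<open>Motions of the arm\<close>

context sphere_chart
begin

lemma Theta_frame_eq:
  assumes "1 \<le> j" "j \<le> k"
  shows "Theta_frame \<phi> c \<theta> j = chart_deriv \<phi> \<theta> j"
proof -
  have "((\<lambda>s. 1 *\<^sub>R \<phi> (\<theta>(j := s)) + c) has_vector_derivative chart_deriv \<phi> \<theta> j + 0) (at (\<theta> j))"
    using has_vector_derivative_add[OF has_vector_derivative_chart_deriv[OF assms] has_vector_derivative_const]
    by simp
  then show ?thesis
    unfolding Theta_frame_def by (simp add: vector_derivative_at)
qed

lemma nu_frame_eq: "nu_frame \<phi> c \<theta> = \<phi> \<theta>"
proof -
  have "((\<lambda>\<rho>. \<rho> *\<^sub>R \<phi> \<theta> + c) has_vector_derivative \<phi> \<theta>) (at 1)"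
    by (auto intro!: derivative_eq_intros)
  then show ?thesis
    unfolding nu_frame_def by (rule vector_derivative_at)
qed

end

lemma angle_dom_regular: "\<theta> \<in> angle_dom k n \<Longrightarrow> i \<le> n \<Longrightarrow> regular_angles k (\<theta> i)"
  by (simp add: angle_dom_def regular_angles_def)

lemma is_orth_proj_span_singleton: "(v - c *\<^sub>R e) \<bullet> e = 0 \<Longrightarrow> is_orth_proj (span {e}) v (c *\<^sub>R e)"
  by (auto simp: is_orth_proj_def orthogonal_def span_singleton)

locale arm_motion = arm_charts k n \<Phi> for k n and \<Phi> :: "nat \<Rightarrow> (nat \<Rightarrow> real) \<Rightarrow> real ^ 'm::enum" +
  fixes I :: "real set" and q :: "real \<Rightarrow> ('m, 'p::enum) arm" and x :: "real \<Rightarrow> real ^ 'm::enum"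
    and \<theta> :: "real \<Rightarrow> nat \<Rightarrow> nat \<Rightarrow> real"
  assumes card_pts: "CARD('p) = n + 2"
    and interval: "is_interval I" "interior I \<noteq> {}"
    and angles: "t \<in> I \<Longrightarrow> \<theta> t \<in> angle_dom k n"
    and chart_motion: "t \<in> I \<Longrightarrow> Gam (q t) = chart_pt \<Phi> (x t) (\<theta> t)"
    and continuous_angles: "i \<le> n \<Longrightarrow> j \<in> {1..k} \<Longrightarrow> continuous_on I (\<lambda>t. \<theta> t i j)"
begin

lemma nontrivial: "t \<in> I \<Longrightarrow> at t within I \<noteq> bot"
  by (rule at_within_interval_nontrivial[OF interval])

lemma regular: "t \<in> I \<Longrightarrow> i \<le> n \<Longrightarrow> regular_angles k (\<theta> t i)"
  using angles angle_dom_regular by blast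

lemma pt_0: "t \<in> I \<Longrightarrow> pt (q t) 0 = x t"
  and link_motion: "t \<in> I \<Longrightarrow> i \<le> n \<Longrightarrow> link (q t) i = \<Phi> i (\<theta> t i)"
  and Conf_motion: "t \<in> I \<Longrightarrow> q t \<in> Conf n"
  using Conf_chart[OF card_pts chart_motion] by blast+

lemma pt_Suc: "t \<in> I \<Longrightarrow> i \<le> n \<Longrightarrow> pt (q t) (Suc i) = pt (q t) i + \<Phi> i (\<theta> t i)"
  by (simp add: link_def flip: link_motion)

section \<open>From kinematic motions to the controlled system\<close>

text \<open>The constraints give \<open>vn\<close> at each time; the angles are then shown
  differentiable, and comparing two expressions for each link velocity yields the angular
  equations.\<close>

lemma kinematic_imp_controlled:
  assumes "kinematic_evolution k n I q"
  shows "\<exists>vt vn. controlled_system k n \<Phi> I x \<theta> vt vn"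
proof -
  obtain v where v: "\<And>t. t \<in> I \<Longrightarrow> (q has_vector_derivative v t) (at t within I)"
    and vE: "\<And>t. t \<in> I \<Longrightarrow> v t \<in> EE k n (q t)"
    using assms unfolding kinematic_evolution_iff[OF card_coords card_pts] by blast
  have orth: "link (v t) i \<bullet> link (q t) i = 0" if "t \<in> I" "i \<le> n" for t i
  proof (rule inner_derivative_of_unit_curve[OF has_vector_derivative_link[OF v[OF that(1)]] _ that(1) nontrivial[OF that(1)]])
    show "link (q s) i \<bullet> link (q s) i = 1" if "s \<in> I" for s
      using Conf_motion[OF that] \<open>i \<le> n\<close> by (simp add: Conf_iff flip: norm_eq_1)
  qed
  have "\<exists>c. \<forall>i\<le>n. pt (v t) i = vel k n \<Phi> (\<theta> t) c i *\<^sub>R \<Phi> i (\<theta> t i)" if "t \<in> I" for t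
  proof -
    have "\<exists>u. \<forall>i\<le>n. pt (v t) i = u i *\<^sub>R \<Phi> i (\<theta> t i)"
      using vE[OF that] link_motion[OF that] by (simp add: EE_iff[OF card_coords card_pts])
    moreover have "\<forall>i\<le>n. (pt (v t) (Suc i) - pt (v t) i) \<bullet> \<Phi> i (\<theta> t i) = 0"
      using orth[OF that] link_motion[OF that] by (simp add: link_def[of "v t"])
    ultimately show ?thesis
      using admissible_velocities_iff[of "pt (v t)" "\<theta> t"] by blast
  qed
  then obtain vn where vn: "\<And>t. t \<in> I \<Longrightarrow> \<forall>i\<le>n. pt (v t) i = vel k n \<Phi> (\<theta> t) (vn t) i *\<^sub>R \<Phi> i (\<theta> t i)"
    by metis
  \<comment> \<open>\<open>vector_derivative\<close> is total, so \<open>a\<close> can be named now;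
    its meaning as a derivative comes with the differentiability proved next.\<close>
  define a where "a i j t = vector_derivative (\<lambda>s. \<theta> s i j) (at t within I)" for i j t
  have link_deriv: "((\<lambda>s. \<Phi> i (\<theta> s i)) has_vector_derivative link (v t) i) (at t within I)"
    if "t \<in> I" "i \<le> n" for t i
    using has_vector_derivative_transform[OF that(1) _ has_vector_derivative_link[OF v[OF that(1)]]]
      link_motion that(2) by metis
  have a: "((\<lambda>s. \<theta> s i j) has_real_derivative a i j t) (at t within I)"
    if "t \<in> I" "i \<le> n" "1 \<le> j" "j \<le> k" for t i j
  proof -
    interpret sphere_chart k "\<Phi> i" by (rule sphere_chart[OF that(2)])
    have "(\<lambda>s. \<Phi> i (\<theta> s i)) differentiable (at t within I)"
      using link_deriv[OF that(1,2)] by (auto simp: differentiable_def has_vector_derivative_def)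
    moreover have "continuous_on I (\<lambda>s. \<theta> s i k)"
      using continuous_angles that k_pos by simp
    ultimately have "(\<lambda>s. \<theta> s i j) differentiable (at t within I)"
      using regular[OF _ that(2)] that
      by (intro differentiable_chart_angles[where \<theta> = "\<lambda>s. \<theta> s i"])
    then show ?thesis
      unfolding a_def by (simp add: vector_derivative_works has_real_derivative_iff_has_vector_derivative)
  qed
  have link_eq: "link (v t) i = (\<Sum>j=1..k. a i j t *\<^sub>R chart_deriv (\<Phi> i) (\<theta> t i) j)"
    if "t \<in> I" "i \<le> n" for t i
    using sphere_chart.has_vector_derivative_chart_curve[OF sphere_chart[OF that(2)], of "\<lambda>s. \<theta> s i", OF a[OF that]]
    by (rule vector_derivative_unique_within[OF nontrivial[OF that(1)] link_deriv[OF that]])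
  \<comment> \<open>The angular velocities of the last link are themselves the tangential
    controls.\<close>
  have "controlled_system k n \<Phi> I x \<theta> (a n) vn"
    unfolding controlled_system_def
  proof (intro ballI conjI allI impI)
    fix t assume t: "t \<in> I"
    have inc: "pt (v t) 0 = vel k n \<Phi> (\<theta> t) (vn t) 0 *\<^sub>R \<Phi> 0 (\<theta> t 0) \<and>
      (\<forall>i<n. pt (v t) (Suc i) - pt (v t) i = vel k n \<Phi> (\<theta> t) (vn t) (Suc i) *\<^sub>R
        (\<Sum>j=1..k. B_fun k \<Phi> (\<theta> t) (Suc i) j *\<^sub>R chart_deriv (\<Phi> i) (\<theta> t i) j))"
      using velocities_iff_increments[of "\<theta> t" "pt (v t)" "vn t"] vn[OF t] regular[OF t] by simp
    {
      fix r
      have "((\<lambda>s. pt (q s) 0) has_vector_derivative pt (v t) 0) (at t within I)"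
        by (rule bounded_linear.has_vector_derivative[OF bounded_linear_pt v[OF t]])
      then have "(x has_vector_derivative pt (v t) 0) (at t within I)"
        by (rule has_vector_derivative_transform[OF t, rotated]) (simp add: pt_0)
      from bounded_linear.has_vector_derivative[OF bounded_linear_co this]
      show "((\<lambda>s. co (x s) r) has_real_derivative
          vel k n \<Phi> (\<theta> t) (vn t) 0 * co (\<Phi> 0 (\<theta> t 0)) r) (at t within I)"
        using inc by (simp add: has_real_derivative_iff_has_vector_derivative co_def)
    }
    {
      fix i j assume i: "i < n" and j: "j \<in> {1..k}"
      interpret sphere_chart k "\<Phi> i" using i by (intro sphere_chart) simp
      \<comment> \<open>The chain rule and the increment formula express the same vector in the
        frame of link \<open>i\<close>; independence then equates the coefficients.\<close>
      have "(\<Sum>j=1..k. a i j t *\<^sub>R chart_deriv (\<Phi> i) (\<theta> t i) j) =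
          (\<Sum>j=1..k. (vel k n \<Phi> (\<theta> t) (vn t) (Suc i) * B_fun k \<Phi> (\<theta> t) (Suc i) j) *\<^sub>R chart_deriv (\<Phi> i) (\<theta> t i) j)"
        using inc i link_eq[OF t, of i] by (simp add: link_def scaleR_sum_right)
      then have "a i j t = vel k n \<Phi> (\<theta> t) (vn t) (Suc i) * B_fun k \<Phi> (\<theta> t) (Suc i) j"
        using regular[OF t] i j by (intro chart_deriv_coeffs_unique[of "\<theta> t i"]) simp_all
      then show "((\<lambda>s. \<theta> s i j) has_real_derivative
          vel k n \<Phi> (\<theta> t) (vn t) (i + 1) * B_fun k \<Phi> (\<theta> t) (i + 1) j) (at t within I)"
        using a[OF t, of i j] i j by simp
    }
    show "((\<lambda>s. \<theta> s n j) has_real_derivative a n j t) (at t within I)" if "j \<in> {1..k}" for j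
      using a[OF t, of n j] that by simp
  qed
  then show ?thesis by blast
qed

section \<open>From the controlled system back to the motion, and the velocity components\<close>

context
  fixes vt vn
  assumes system: "controlled_system k n \<Phi> I x \<theta> vt vn"
begin

text \<open>Induction along the arm: adding the velocity of link \<open>i\<close> to that of point
  \<open>i\<close> cancels the term along link \<open>i\<close>, by
  \<open>vel_increment\<close>.\<close>

lemma velocity_inner_points:
  assumes t: "t \<in> I" and "i \<le> n"
  shows "((\<lambda>s. pt (q s) i) has_vector_derivative vel k n \<Phi> (\<theta> t) (vn t) i *\<^sub>R \<Phi> i (\<theta> t i)) (at t within I)"
  using assms(2)
proof (induction i)
  case 0
  have "((\<lambda>s. of_cos (co (x s)) :: real ^ 'm::enum) has_vector_derivative
      of_cos (\<lambda>r. vel k n \<Phi> (\<theta> t) (vn t) 0 * co (\<Phi> 0 (\<theta> t 0)) r)) (at t within I)"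
    using system t card_coords
    by (intro has_vector_derivative_of_cos) (simp add: controlled_system_def)
  moreover have "(of_cos (\<lambda>r. vel k n \<Phi> (\<theta> t) (vn t) 0 * co (\<Phi> 0 (\<theta> t 0)) r) :: real ^ 'm::enum) =
      vel k n \<Phi> (\<theta> t) (vn t) 0 *\<^sub>R \<Phi> 0 (\<theta> t 0)"
    using of_cos_co[of "vel k n \<Phi> (\<theta> t) (vn t) 0 *\<^sub>R \<Phi> 0 (\<theta> t 0)"] by (simp add: co_def[abs_def])
  ultimately have "(x has_vector_derivative vel k n \<Phi> (\<theta> t) (vn t) 0 *\<^sub>R \<Phi> 0 (\<theta> t 0)) (at t within I)"
    by (simp add: of_cos_co)
  then show ?case
    by (rule has_vector_derivative_transform[OF t, rotated]) (simp add: pt_0)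
next
  case (Suc i)
  then have i: "i < n" by simp
  let ?a = "\<lambda>j. vel k n \<Phi> (\<theta> t) (vn t) (Suc i) * B_fun k \<Phi> (\<theta> t) (Suc i) j"
  have "((\<lambda>s. \<Phi> i (\<theta> s i)) has_vector_derivative (\<Sum>j=1..k. ?a j *\<^sub>R chart_deriv (\<Phi> i) (\<theta> t i) j)) (at t within I)"
    using system t i
    by (intro sphere_chart.has_vector_derivative_chart_curve[OF sphere_chart]) (simp_all add: controlled_system_def)
  moreover have "(\<Sum>j=1..k. ?a j *\<^sub>R chart_deriv (\<Phi> i) (\<theta> t i) j) =
      vel k n \<Phi> (\<theta> t) (vn t) (Suc i) *\<^sub>R \<Phi> (Suc i) (\<theta> t (Suc i)) - vel k n \<Phi> (\<theta> t) (vn t) i *\<^sub>R \<Phi> i (\<theta> t i)"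
    using vel_increment[where \<theta> = "\<theta> t", OF i regular[OF t], of "vn t"] i by (simp add: scaleR_sum_right)
  ultimately have "((\<lambda>s. pt (q s) i + \<Phi> i (\<theta> s i)) has_vector_derivative
      vel k n \<Phi> (\<theta> t) (vn t) (Suc i) *\<^sub>R \<Phi> (Suc i) (\<theta> t (Suc i))) (at t within I)"
    using has_vector_derivative_add[OF Suc.IH] i by fastforce
  then show ?case
  proof (rule has_vector_derivative_transform[OF t, rotated])
    show "pt (q s) (Suc i) = pt (q s) i + \<Phi> i (\<theta> s i)" if "s \<in> I" for s
      using that i by (simp add: pt_Suc)
  qed
qed

text \<open>Here the last link turns with the free controls \<open>vt\<close>, so nothing cancels
  and the normal speed \<open>vn t\<close> survives.\<close>

lemma velocity_end_point:
  assumes t: "t \<in> I"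
  shows "((\<lambda>s. pt (q s) (Suc n)) has_vector_derivative
    vn t *\<^sub>R \<Phi> n (\<theta> t n) + (\<Sum>j=1..k. vt j t *\<^sub>R chart_deriv (\<Phi> n) (\<theta> t n) j)) (at t within I)"
proof -
  have "((\<lambda>s. \<Phi> n (\<theta> s n)) has_vector_derivative (\<Sum>j=1..k. vt j t *\<^sub>R chart_deriv (\<Phi> n) (\<theta> t n) j)) (at t within I)"
    using system t
    by (intro sphere_chart.has_vector_derivative_chart_curve[OF sphere_chart]) (simp_all add: controlled_system_def)
  from has_vector_derivative_add[OF velocity_inner_points[OF t order_refl] this]
  show ?thesis
    unfolding vel_last
  proof (rule has_vector_derivative_transform[OF t, rotated])
    show "pt (q s) (Suc n) = pt (q s) n + \<Phi> n (\<theta> s n)" if "s \<in> I" for s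
      using that by (simp add: pt_Suc)
  qed
qed

lemma controlled_imp_kinematic: "kinematic_evolution k n I q"
proof -
  define v :: "real \<Rightarrow> ('m, 'p) arm" where
    "v t = of_pts (\<lambda>i. if i \<le> n then vel k n \<Phi> (\<theta> t) (vn t) i *\<^sub>R \<Phi> i (\<theta> t i)
      else vn t *\<^sub>R \<Phi> n (\<theta> t n) + (\<Sum>j=1..k. vt j t *\<^sub>R chart_deriv (\<Phi> n) (\<theta> t n) j))" for t
  have "(q has_vector_derivative v t) (at t within I)" if "t \<in> I" for t
  proof (rule has_vector_derivative_arm_iff[THEN iffD2], intro allI impI)
    fix i assume i: "i < CARD('p)"
    show "((\<lambda>s. pt (q s) i) has_vector_derivative pt (v t) i) (at t within I)"
    proof (cases "i \<le> n")
      case True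
      then show ?thesis
        using i velocity_inner_points[OF that True] by (simp add: v_def pt_of_pts)
    next
      case False
      then have "i = Suc n" using i card_pts by simp
      then show ?thesis
        using i velocity_end_point[OF that] by (simp add: v_def pt_of_pts)
    qed
  qed
  moreover have "v t \<in> EE k n (q t)" if "t \<in> I" for t
    unfolding EE_iff[OF card_coords card_pts] using link_motion[OF that] card_pts
    \<comment> \<open>The speeds \<open>vel\<close> serve as the controls of the fields
      \<open>ZZ\<close>; the velocity of the end point is unrestricted in \<open>EE\<close>.\<close>
    by (intro exI[of _ "vel k n \<Phi> (\<theta> t) (vn t)"]) (simp add: v_def pt_of_pts)
  ultimately show ?thesis
    unfolding kinematic_evolution_iff[OF card_coords card_pts] using Conf_motion by blast
qed

text \<open>The velocity of the end point is a multiple of the normal plus a combination of the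
  tangent frame; removing the latter leaves a vector orthogonal to the tangent space.\<close>

lemma tangential_velocity:
  assumes t: "t \<in> I"
  defines "T \<equiv> tangent_space (sphere (pt (q t) n) 1) (pt (q t) (n + 1))"
    and "\<Theta> \<equiv> Theta_frame (\<Phi> n) (pt (q t) n) (\<theta> t n)"
  shows "is_basis_of \<Theta> {1..k} T"
    and "is_orth_proj T (vector_derivative (\<lambda>s. pt (q s) (n + 1)) (at t within I)) (\<Sum>j=1..k. vt j t *\<^sub>R \<Theta> j)"
proof -
  interpret sphere_chart k "\<Phi> n" by (rule sphere_chart) simp
  have link: "pt (q t) (n + 1) - pt (q t) n = \<Phi> n (\<theta> t n)"
    using link_motion[OF t, of n] by (simp add: link_def)
  have reg: "regular_angles k (\<theta> t n)" by (rule regular[OF t]) simp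
  have T: "T = {v. v \<bullet> \<Phi> n (\<theta> t n) = 0}"
    unfolding T_def using tangent_space_sphere[of "pt (q t) (n + 1)" "pt (q t) n"] by (simp only: link norm_chart)
  have \<Theta>: "\<Theta> j = chart_deriv (\<Phi> n) (\<theta> t n) j" if "j \<in> {1..k}" for j
    unfolding \<Theta>_def using that by (intro Theta_frame_eq) auto
  have "\<Theta> ` {1..k} = chart_deriv (\<Phi> n) (\<theta> t n) ` {1..k}"
    by (rule image_cong[OF refl \<Theta>])
  moreover have "inj_on \<Theta> {1..k}"
    by (subst inj_on_cong[OF \<Theta>], assumption) (rule inj_on_chart_deriv[OF reg])
  ultimately show "is_basis_of \<Theta> {1..k} T"
    unfolding is_basis_of_def T using independent_chart_deriv[OF reg] span_chart_deriv[OF reg] by simp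
  have sum: "(\<Sum>j=1..k. vt j t *\<^sub>R \<Theta> j) = (\<Sum>j=1..k. vt j t *\<^sub>R chart_deriv (\<Phi> n) (\<theta> t n) j)"
    using \<Theta> by (intro sum.cong) simp_all
  have vd: "vector_derivative (\<lambda>s. pt (q s) (n + 1)) (at t within I) =
      vn t *\<^sub>R \<Phi> n (\<theta> t n) + (\<Sum>j=1..k. vt j t *\<^sub>R \<Theta> j)"
    unfolding sum using vector_derivative_within[OF nontrivial[OF t] velocity_end_point[OF t]] by simp
  have "(\<Sum>j=1..k. vt j t *\<^sub>R \<Theta> j) \<in> T"
    unfolding sum T span_chart_deriv[OF reg, symmetric] by (intro span_sum span_scale span_base) auto
  then show "is_orth_proj T (vector_derivative (\<lambda>s. pt (q s) (n + 1)) (at t within I)) (\<Sum>j=1..k. vt j t *\<^sub>R \<Theta> j)"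
    unfolding vd is_orth_proj_def by (simp add: T orthogonal_def inner_commute)
qed

text \<open>At the end point the tangential part drops out. An inner point moves along its next
  link, and projecting on the previous one multiplies the speed by \<open>A_fun\<close>, which is
  the recursion for \<open>vel\<close>.\<close>

lemma normal_velocity:
  assumes t: "t \<in> I" and i: "i \<in> {1..n+1}"
  defines "\<nu> \<equiv> nu_frame (\<Phi> (i - 1)) (pt (q t) (i - 1)) (\<theta> t (i - 1))"
  shows "is_orth_proj (span {\<nu>}) (vector_derivative (\<lambda>s. pt (q s) i) (at t within I))
    (vel k n \<Phi> (\<theta> t) (vn t) (i - 1) *\<^sub>R \<nu>)"
proof -
  obtain l where l: "i = Suc l" "l \<le> n" using i by (cases i) auto
  interpret sphere_chart k "\<Phi> l" by (rule sphere_chart[OF l(2)])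
  have \<nu>: "\<nu> = \<Phi> l (\<theta> t l)" by (simp add: \<nu>_def l nu_frame_eq)
  have "(vector_derivative (\<lambda>s. pt (q s) i) (at t within I) - vel k n \<Phi> (\<theta> t) (vn t) l *\<^sub>R \<Phi> l (\<theta> t l)) \<bullet> \<Phi> l (\<theta> t l) = 0"
  proof (cases "l = n")
    case True
    have "(\<Sum>j=1..k. vt j t *\<^sub>R chart_deriv (\<Phi> l) (\<theta> t l) j) \<bullet> \<Phi> l (\<theta> t l) = 0"
      unfolding inner_sum_left by (intro sum.neutral) (simp add: inner_chart_deriv_chart)
    then show ?thesis
      using True vector_derivative_within[OF nontrivial[OF t] velocity_end_point[OF t]]
      by (simp add: l(1) vel_last)
  next
    case False
    then have ln: "l < n" using l by simp
    then have "vector_derivative (\<lambda>s. pt (q s) (Suc l)) (at t within I) =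
        vel k n \<Phi> (\<theta> t) (vn t) (Suc l) *\<^sub>R \<Phi> (Suc l) (\<theta> t (Suc l))"
      by (intro vector_derivative_within[OF nontrivial[OF t] velocity_inner_points[OF t]]) simp
    then show ?thesis
      using ln by (simp add: l(1) inner_diff_left inner_chart_self vel_Suc A_fun_eq
          inner_commute[of "\<Phi> (Suc l) (\<theta> t (Suc l))"])
  qed
  then show ?thesis
    unfolding \<nu> l(1) diff_Suc_1 by (rule is_orth_proj_span_singleton)
qed

end

end

theorem theorem4p1:
  fixes k n :: nat
  assumes "k \<ge> 1" and "n \<ge> 1"
    and "CARD('m::enum) = k + 1" and "CARD('p::enum) = n + 2"
  shows
    "(\<forall>p \<in> (SS n :: ('m, 'p) arm set).
        (\<exists>\<Phi> x \<theta>. hyper_charts k n \<Phi> \<and> \<theta> \<in> angle_dom k n \<and> chart_pt \<Phi> x \<theta> = p) \<and>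
        (\<forall>\<Phi> x \<theta>. hyper_charts k n \<Phi> \<and> \<theta> \<in> angle_dom k n \<and> chart_pt \<Phi> x \<theta> = p \<longrightarrow>
           Delta_n k n \<Phi> x \<theta> = image_distribution Gam (Conf n) (Delta k n) p))
     \<and>
     (\<forall>(\<Phi> :: 'm charts) I (q :: real \<Rightarrow> ('m, 'p) arm) x \<theta>.
        hyper_charts k n \<Phi> \<and> is_interval I \<and> interior I \<noteq> {} \<and>
        (\<forall>t\<in>I. \<theta> t \<in> angle_dom k n \<and> Gam (q t) = chart_pt \<Phi> (x t) (\<theta> t)) \<and>
        (\<forall>i\<in>{0..n}. \<forall>j\<in>{1..k}. continuous_on I (\<lambda>t. \<theta> t i j))
        \<longrightarrow>
        (kinematic_evolution k n I q \<longleftrightarrow> (\<exists>vt vn. controlled_system k n \<Phi> I x \<theta> vt vn)) \<and>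
        (\<forall>vt vn. controlled_system k n \<Phi> I x \<theta> vt vn \<longrightarrow> (\<forall>t\<in>I.
           (let T = tangent_space (sphere (pt (q t) n) 1) (pt (q t) (n + 1));
                \<Theta> = Theta_frame (\<Phi> n) (pt (q t) n) (\<theta> t n)
            in is_basis_of \<Theta> {1..k} T \<and>
               is_orth_proj T (vector_derivative (\<lambda>s. pt (q s) (n + 1)) (at t within I))
                 (\<Sum>j=1..k. vt j t *\<^sub>R \<Theta> j)) \<and>
           (\<forall>i\<in>{1..n+1}.
              let \<nu> = nu_frame (\<Phi> (i - 1)) (pt (q t) (i - 1)) (\<theta> t (i - 1))
              in is_orth_proj (span {\<nu>}) (vector_derivative (\<lambda>s. pt (q s) i) (at t within I))
                   (vel k n \<Phi> (\<theta> t) (vn t) (i - 1) *\<^sub>R \<nu>)))))"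
proof (intro conjI ballI allI impI)
  note card = assms(3,4)
  fix p :: "('m, 'p) arm" assume p: "p \<in> SS n"
  show "\<exists>\<Phi> x \<theta>. hyper_charts k n \<Phi> \<and> \<theta> \<in> angle_dom k n \<and> chart_pt \<Phi> x \<theta> = p"
    by (rule exists_hyper_charts[OF card p])
  fix \<Phi> :: "'m charts" and x \<theta>
  assume *: "hyper_charts k n \<Phi> \<and> \<theta> \<in> angle_dom k n \<and> chart_pt \<Phi> x \<theta> = p"
  then interpret arm_charts k n \<Phi>
    using assms by unfold_locales auto
  have "regular_angles k (\<theta> i)" if "i \<le> n" for i
    using * that by (intro angle_dom_regular) auto
  from Delta_n_eq_image[OF card(2) this] *
  show "Delta_n k n \<Phi> x \<theta> = image_distribution Gam (Conf n) (Delta k n) p" by simp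
next
  fix \<Phi> :: "'m charts" and I and q :: "real \<Rightarrow> ('m, 'p) arm" and x \<theta>
  assume *: "hyper_charts k n \<Phi> \<and> is_interval I \<and> interior I \<noteq> {} \<and>
        (\<forall>t\<in>I. \<theta> t \<in> angle_dom k n \<and> Gam (q t) = chart_pt \<Phi> (x t) (\<theta> t)) \<and>
        (\<forall>i\<in>{0..n}. \<forall>j\<in>{1..k}. continuous_on I (\<lambda>t. \<theta> t i j))"
  then interpret arm_motion k n \<Phi> I q x \<theta>
    using assms by unfold_locales auto
  show "kinematic_evolution k n I q \<longleftrightarrow> (\<exists>vt vn. controlled_system k n \<Phi> I x \<theta> vt vn)"
    using kinematic_imp_controlled controlled_imp_kinematic by blast
  fix vt vn t assume system: "controlled_system k n \<Phi> I x \<theta> vt vn" and t: "t \<in> I"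
  show "let T = tangent_space (sphere (pt (q t) n) 1) (pt (q t) (n + 1));
            \<Theta> = Theta_frame (\<Phi> n) (pt (q t) n) (\<theta> t n)
        in is_basis_of \<Theta> {1..k} T \<and>
           is_orth_proj T (vector_derivative (\<lambda>s. pt (q s) (n + 1)) (at t within I))
             (\<Sum>j=1..k. vt j t *\<^sub>R \<Theta> j)"
    unfolding Let_def using tangential_velocity[OF system t] by blast
  show "let \<nu> = nu_frame (\<Phi> (i - 1)) (pt (q t) (i - 1)) (\<theta> t (i - 1))
        in is_orth_proj (span {\<nu>}) (vector_derivative (\<lambda>s. pt (q s) i) (at t within I))
             (vel k n \<Phi> (\<theta> t) (vn t) (i - 1) *\<^sub>R \<nu>)" if "i \<in> {1..n+1}" for i
    unfolding Let_def by (rule normal_velocity[OF system t that])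
qed

end
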